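(* There exist a quantum graph $f$ and real numbers $0 \le \alpha_1 < \alpha_2 \le 1$ such that the function $\psi$ defined by $$\psi(x)=\min\{\, t(K_2;W) \;:\; W \text{ a graphon with } t(f;W)=0 \text{ and } t(P_4;W)=x \,\}$$ is nowhere differentiable in the interval $[\alpha_1,\alpha_2]$.
   Context: All graphs are finite and simple. A graphon is a symmetric measurable function $W:[0,1]^2\to[0,1]$. For a graph $F$, the induced homomorphism density of $F$ in $W$ is $$t(F;W)=\mathbb{E}\Big[\prod_{uv\in E(F)}W(x_u,x_v)\prod_{\{u,v\}\notin E(F),\,u\ne v}\big(1-W(x_u,x_v)\big)\Big],$$ where $(x_u)_{u\in V(F)}$ are independent uniform random variables on $[0,1]$; $t(\emptyset;W)=1$ for the graph $\emptyset$ with no vertices. A quantum graph is a formal finite real linear combination $f=\sum_i \alpha_i H_i$ of graphs, and $t(f;W):=\sum_i\alpha_i t(H_i;W)$. $K_2$ is the graph consisting of a single edge and $P_4$ is the path on $4$ vertices. *)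

theory Defs
  imports "HOL-Probability.Probability" "HOL-Library.Poly_Mapping"
begin

text \<open>Every finite simple graph is isomorphic to one whose vertices are natural numbers.\<close>

typedef sgraph = "{(V :: nat set, E :: nat set set). finite V \<and> E \<subseteq> {e. e \<subseteq> V \<and> card e = 2}}"
  morphisms rep_sgraph Abs_sgraph
  by (rule exI[of _ "({}, {})"]) simp

setup_lifting type_definition_sgraph

lift_definition verts :: "sgraph \<Rightarrow> nat set" is fst .

lift_definition edges :: "sgraph \<Rightarrow> nat set set" is snd .

lift_definition K2 :: sgraph is "({0, 1}, {{0, 1}})"
  by auto

lift_definition P4 :: sgraph is "({0, 1, 2, 3}, {{0, 1}, {1, 2}, {2, 3}})"
  by auto

type_synonym quantum_graph = "sgraph \<Rightarrow>\<^sub>0 real"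

text \<open>The underlying space is \<open>{0..1}\<close> itself rather than \<open>UNIV\<close>, so that the values of a
  graphon outside the unit square affect neither measurability nor integrals.\<close>

definition unit_interval :: "real measure" where
  "unit_interval = restrict_space lborel {0..1}"

definition graphon :: "(real \<Rightarrow> real \<Rightarrow> real) \<Rightarrow> bool" where
  "graphon W \<longleftrightarrow>
     case_prod W \<in> borel_measurable (unit_interval \<Otimes>\<^sub>M unit_interval) \<and>
     (\<forall>x\<in>{0..1}. \<forall>y\<in>{0..1}. W x y \<in> {0..1} \<and> W x y = W y x)"

text \<open>Each unordered pair of distinct vertices is represented by the pair \<open>(u, v)\<close> with
  \<open>u < v\<close>; for symmetric \<open>W\<close> the choice of order is irrelevant.\<close>

definition ind_density :: "sgraph \<Rightarrow> (real \<Rightarrow> real \<Rightarrow> real) \<Rightarrow> real" where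
  "ind_density F W =
     (\<integral>x. (\<Prod>(u, v)\<in>{(u, v). u \<in> verts F \<and> v \<in> verts F \<and> u < v \<and> {u, v} \<in> edges F}.
             W (x u) (x v)) *
          (\<Prod>(u, v)\<in>{(u, v). u \<in> verts F \<and> v \<in> verts F \<and> u < v \<and> {u, v} \<notin> edges F}.
             1 - W (x u) (x v))
      \<partial>(\<Pi>\<^sub>M u\<in>verts F. unit_interval))"

definition q_density :: "quantum_graph \<Rightarrow> (real \<Rightarrow> real \<Rightarrow> real) \<Rightarrow> real" where
  "q_density f W = (\<Sum>H\<in>Poly_Mapping.keys f. Poly_Mapping.lookup f H * ind_density H W)"

definition feasible :: "quantum_graph \<Rightarrow> real \<Rightarrow> real set" where
  "feasible f x =
     {ind_density K2 W | W. graphon W \<and> q_density f W = 0 \<and> ind_density P4 W = x}"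

text \<open>Meaningful only where \<open>feasible f x\<close> has a least element.\<close>

definition psi :: "quantum_graph \<Rightarrow> real \<Rightarrow> real" where
  "psi f x = (LEAST d. d \<in> feasible f x)"

end

theory Submission
  imports Defs
begin

text \<open>Put \<open>U = 1 - W\<close>. Products of densities are densities of disjoint unions, so every polynomial
  in densities can be written as \<open>q_density f\<close>. We choose one that vanishes exactly when almost every
  vertex has \<open>U\<close>-degree \<open>7/16\<close>, \<open>d\<close> or \<open>2 d\<close>, the last two kinds lying in cliques of \<open>U\<close> that are
  components, where \<open>d\<close> and the proportions of the three kinds are prescribed by the edge density and
  the density of \<open>P4\<close>. In terms of \<open>s\<close>, a multiple of the density of \<open>P4\<close>, the cliques of size \<open>2 d\<close>
  cover \<open>s / 4\<close> and those of size \<open>d\<close> cover \<open>1/8 - s / 4\<close>. Counting cliques shows that \<open>d = 0\<close> or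
  \<open>d = 1 / (8 n)\<close> with \<open>s n\<close> an integer. The edge density of \<open>W\<close> is \<open>79/128 - d (1 + 2 s) / 8\<close>, so
  minimising it produces Thomae's function of \<open>s\<close>, up to a smooth positive factor. The vertices of
  degree \<open>7/16\<close> form a block whose \<open>P4\<close> density can be adjusted freely.\<close>

section \<open>The algebra of densities\<close>

text \<open>The obstacle is to extract arithmetic from continuous data. It comes from tiling: if
  parts of equal measure exhaust a set of prescribed measure, the quotient is an integer. One clique
  size would only restrict d; the second size, covering a measure proportional to s, ties the number
  of cliques to s. The size d is left free and shows in the edge density, so minimising means taking
  the largest admissible d, that is the least denominator of s. The value d = 0 stays admissible and
  keeps irrational s feasible. P4 serves as the parameter because its complement is connected, so
  the cliques do not affect its density. The block must then vary its P4 density without moving any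
  degree. Two halves with U-density p inside and 1 - p across do this: every degree is 7/16, while
  the P4 density runs from (7/8)^4/64 at p = 1/2 to 0 at p = 1. Cliques are recognised by the
  absence of induced cherries in U, which the block may contain; hence the weight (degree - 7/16)^2.
  The measure 1/8 left outside the block is too small for cliques of measure 7/32 or 7/8, which
  excludes the coincidences 2 d = 7/16 and d = 7/16.\<close>

lemma space_unit_interval [simp]: "space unit_interval = {0..1}"
  by (simp add: unit_interval_def space_restrict_space)

lemma prob_space_unit_interval: "prob_space unit_interval"
  by (rule prob_spaceI)
    (simp add: unit_interval_def emeasure_restrict_space space_restrict_space)

interpretation UI: prob_space unit_interval
  by (rule prob_space_unit_interval)

interpretation UIP: product_sigma_finite "\<lambda>_::nat. unit_interval"
  by unfold_locales

interpretation UI2: pair_prob_space unit_interval unit_interval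
  by unfold_locales

lemma prob_space_cube: "prob_space (\<Pi>\<^sub>M u\<in>V. unit_interval)"
  by (intro prob_space_PiM prob_space_unit_interval)

section \<open>Densities of partially specified graphs, and the algebra of representable
  functionals\<close>

definition monomial :: "(nat \<times> nat) set \<Rightarrow> (nat \<times> nat) set \<Rightarrow> (real \<Rightarrow> real \<Rightarrow> real) \<Rightarrow> (nat \<Rightarrow> real) \<Rightarrow> real" where
  "monomial A B W x = (\<Prod>(u, v)\<in>A. W (x u) (x v)) * (\<Prod>(u, v)\<in>B. 1 - W (x u) (x v))"

text \<open>Pairs of \<open>vpairs V\<close> in neither \<open>A\<close> nor \<open>B\<close> are
  left free. This freedom is what lets products and powers of degrees be written as
  densities.\<close>

definition monomial_density :: "nat set \<Rightarrow> (nat \<times> nat) set \<Rightarrow> (nat \<times> nat) set \<Rightarrow> (real \<Rightarrow> real \<Rightarrow> real) \<Rightarrow> real" where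
  "monomial_density V A B W = (\<integral>x. monomial A B W x \<partial>(\<Pi>\<^sub>M u\<in>V. unit_interval))"

definition vpairs :: "nat set \<Rightarrow> (nat \<times> nat) set" where
  "vpairs V = {(u, v). u \<in> V \<and> v \<in> V \<and> u < v}"

lemma finite_vpairs [simp]: "finite V \<Longrightarrow> finite (vpairs V)"
  by (rule finite_subset[of _ "V \<times> V"]) (auto simp: vpairs_def)

lemma graphonD:
  assumes "graphon W"
  shows "case_prod W \<in> borel_measurable (unit_interval \<Otimes>\<^sub>M unit_interval)"
    and "x \<in> {0..1} \<Longrightarrow> y \<in> {0..1} \<Longrightarrow> 0 \<le> W x y"
    and "x \<in> {0..1} \<Longrightarrow> y \<in> {0..1} \<Longrightarrow> W x y \<le> 1"
    and "x \<in> {0..1} \<Longrightarrow> y \<in> {0..1} \<Longrightarrow> W x y = W y x"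
  using assms unfolding graphon_def by force+

lemma graphon_measurable2:
  assumes "graphon W" and [measurable]: "f \<in> measurable M unit_interval" "g \<in> measurable M unit_interval"
  shows "(\<lambda>x. W (f x) (g x)) \<in> borel_measurable M"
proof -
  note graphonD(1)[OF assms(1), measurable]
  have "(\<lambda>x. case_prod W (f x, g x)) \<in> borel_measurable M"
    by measurable
  then show ?thesis by simp
qed

lemma monomial_measurable:
  assumes "graphon W" "A \<subseteq> vpairs V" "B \<subseteq> vpairs V"
  shows "monomial A B W \<in> borel_measurable (\<Pi>\<^sub>M u\<in>V. unit_interval)"
proof -
  have *: "(\<lambda>x. W (x u) (x v)) \<in> borel_measurable (\<Pi>\<^sub>M u\<in>V. unit_interval)" if "u \<in> V" "v \<in> V" for u v
    using that by (intro graphon_measurable2 assms measurable_component_singleton)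
  show ?thesis unfolding monomial_def
    using assms * by (intro borel_measurable_times borel_measurable_prod)
      (auto simp: vpairs_def intro!: borel_measurable_diff)
qed

lemma monomial_bounds:
  assumes "graphon W" "A \<subseteq> vpairs V" "B \<subseteq> vpairs V" "x \<in> V \<rightarrow> {0..1}"
  shows "0 \<le> monomial A B W x" "monomial A B W x \<le> 1"
proof -
  have W: "0 \<le> W (x u) (x v)" "W (x u) (x v) \<le> 1" if "(u, v) \<in> vpairs V" for u v
    using graphonD(2,3)[OF assms(1), of "x u" "x v"] that assms(4) by (auto simp: vpairs_def Pi_iff)
  have A: "0 \<le> (\<Prod>(u, v)\<in>A. W (x u) (x v))" "(\<Prod>(u, v)\<in>A. W (x u) (x v)) \<le> 1"
    using W assms(2) by (auto intro!: prod_nonneg prod_le_1)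
  have B: "0 \<le> (\<Prod>(u, v)\<in>B. 1 - W (x u) (x v))" "(\<Prod>(u, v)\<in>B. 1 - W (x u) (x v)) \<le> 1"
    using W assms(3) by (auto intro!: prod_nonneg prod_le_1)
  show "0 \<le> monomial A B W x" "monomial A B W x \<le> 1"
    unfolding monomial_def using A B by (auto intro: mult_le_one)
qed

lemma integrable_bounded_prob:
  fixes f :: "'a \<Rightarrow> real"
  assumes "prob_space M" "f \<in> borel_measurable M" "\<And>x. x \<in> space M \<Longrightarrow> \<bar>f x\<bar> \<le> B"
  shows "integrable M f"
proof -
  interpret prob_space M by fact
  show ?thesis using assms by (intro integrable_const_bound[of _ B]) auto
qed

lemma monomial_integrable:
  assumes "graphon W" "A \<subseteq> vpairs V" "B \<subseteq> vpairs V"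
  shows "integrable (\<Pi>\<^sub>M u\<in>V. unit_interval) (monomial A B W)"
  using monomial_bounds[OF assms]
  by (intro integrable_bounded_prob[where B = 1] prob_space_cube monomial_measurable assms)
     (force simp: space_PiM PiE_def)

text \<open>Closure properties of this predicate replace an explicit construction of the quantum
  graph. Agreement is asked for on graphons only, where measurability and boundedness justify the
  exchanges of integrals.\<close>

definition representable :: "((real \<Rightarrow> real \<Rightarrow> real) \<Rightarrow> real) \<Rightarrow> bool" where
  "representable \<phi> \<longleftrightarrow> (\<exists>f. \<forall>W. graphon W \<longrightarrow> q_density f W = \<phi> W)"

lemma representable_cong:
  assumes "representable \<phi>" "\<And>W. graphon W \<Longrightarrow> \<phi> W = \<psi> W"
  shows "representable \<psi>"
  using assms unfolding representable_def by metis

lemma representable_ind_density: "representable (ind_density H)"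
  unfolding representable_def
  by (rule exI[of _ "Poly_Mapping.single H 1"]) (simp add: q_density_def)

lemma q_density_superset:
  assumes "finite K" "Poly_Mapping.keys f \<subseteq> K"
  shows "q_density f W = (\<Sum>H\<in>K. Poly_Mapping.lookup f H * ind_density H W)"
  unfolding q_density_def using assms
  by (intro sum.mono_neutral_left) (auto simp: in_keys_iff)

lemma q_density_add: "q_density (f + g) W = q_density f W + q_density g W"
proof -
  let ?K = "Poly_Mapping.keys f \<union> Poly_Mapping.keys g"
  have "q_density (f + g) W = (\<Sum>H\<in>?K. Poly_Mapping.lookup (f + g) H * ind_density H W)"
    by (rule q_density_superset) (auto simp: keys_add)
  also have "\<dots> = (\<Sum>H\<in>?K. Poly_Mapping.lookup f H * ind_density H W)
      + (\<Sum>H\<in>?K. Poly_Mapping.lookup g H * ind_density H W)"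
    by (simp add: lookup_add sum.distrib algebra_simps)
  also have "\<dots> = q_density f W + q_density g W"
    by (subst (1 2) q_density_superset[of ?K]) auto
  finally show ?thesis .
qed

lemma q_density_scale: "q_density (Poly_Mapping.map ((*) c) f) W = c * q_density f W"
proof -
  have l: "Poly_Mapping.lookup (Poly_Mapping.map ((*) c) f) H = c * Poly_Mapping.lookup f H" for H
    by (simp add: Poly_Mapping.map.rep_eq when_def)
  have "q_density (Poly_Mapping.map ((*) c) f) W
      = (\<Sum>H\<in>Poly_Mapping.keys f. Poly_Mapping.lookup (Poly_Mapping.map ((*) c) f) H * ind_density H W)"
    by (rule q_density_superset) (auto simp: in_keys_iff l)
  then show ?thesis
    by (simp add: l q_density_def sum_distrib_left mult.assoc)
qed

lemma representable_add:
  "representable \<phi> \<Longrightarrow> representable \<psi> \<Longrightarrow> representable (\<lambda>W. \<phi> W + \<psi> W)"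
  unfolding representable_def by (metis q_density_add)

lemma representable_scale: "representable \<phi> \<Longrightarrow> representable (\<lambda>W. c * \<phi> W)"
  unfolding representable_def by (metis q_density_scale)

lemma representable_diff:
  assumes "representable \<phi>" "representable \<psi>"
  shows "representable (\<lambda>W. \<phi> W - \<psi> W)"
  using representable_add[OF assms(1) representable_scale[OF assms(2), of "-1"]] by simp

lemma representable_zero: "representable (\<lambda>W. 0)"
  using representable_scale[OF representable_ind_density, of 0] by simp

lemma representable_sum:
  assumes "\<And>i. i \<in> I \<Longrightarrow> representable (\<phi> i)"
  shows "representable (\<lambda>W. \<Sum>i\<in>I. \<phi> i W)"
proof (cases "finite I")
  case True
  then show ?thesis using assms
    by (induction I rule: finite_induct) (auto intro: representable_add representable_zero)
qed (simp add: representable_zero)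

definition edge_pairs :: "sgraph \<Rightarrow> (nat \<times> nat) set" where
  "edge_pairs H = {(u, v). u \<in> verts H \<and> v \<in> verts H \<and> u < v \<and> {u, v} \<in> edges H}"

lemma edge_pairs_subset: "edge_pairs H \<subseteq> vpairs (verts H)"
  by (auto simp: edge_pairs_def vpairs_def)

lemma finite_verts [simp]: "finite (verts H)"
  by transfer auto

lemma ind_density_eq:
  "ind_density H W = monomial_density (verts H) (edge_pairs H) (vpairs (verts H) - edge_pairs H) W"
proof -
  have "vpairs (verts H) - edge_pairs H =
    {(u, v). u \<in> verts H \<and> v \<in> verts H \<and> u < v \<and> {u, v} \<notin> edges H}"
    by (auto simp: edge_pairs_def vpairs_def)
  then show ?thesis
    unfolding ind_density_def monomial_density_def monomial_def edge_pairs_def by simp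
qed

lemma ex_sgraph:
  assumes "finite V" "E \<subseteq> vpairs V"
  shows "\<exists>H. verts H = V \<and> edge_pairs H = E"
proof -
  let ?S = "(V, (\<lambda>(u, v). {u, v}) ` E)"
  have S: "?S \<in> {(V :: nat set, E :: nat set set). finite V \<and> E \<subseteq> {e. e \<subseteq> V \<and> card e = 2}}"
    using assms by (auto simp: vpairs_def)
  have 1: "verts (Abs_sgraph ?S) = V" "edges (Abs_sgraph ?S) = (\<lambda>(u, v). {u, v}) ` E"
    using Abs_sgraph_inverse[OF S] by (simp_all add: verts.rep_eq edges.rep_eq)
  have "edge_pairs (Abs_sgraph ?S) = E"
    unfolding edge_pairs_def 1 using assms(2) by (force simp: vpairs_def doubleton_eq_iff)
  with 1 show ?thesis by blast
qed

text \<open>Each undecided pair contributes a factor \<open>W + (1 - W) = 1\<close>; expanding the product of these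
  writes a monomial as a sum of induced densities.\<close>

lemma representable_monomial_density:
  assumes V: "finite V" and A: "A \<subseteq> vpairs V" and B: "B \<subseteq> vpairs V" and AB: "A \<inter> B = {}"
  shows "representable (monomial_density V A B)"
proof -
  define R where "R = vpairs V - A - B"
  have fin: "finite A" "finite B" "finite R"
    using V A B by (auto simp: R_def intro: finite_subset[OF _ finite_vpairs])
  have sub: "A \<union> X \<subseteq> vpairs V" "B \<union> (R - X) \<subseteq> vpairs V" if "X \<in> Pow R" for X
    using that A B by (auto simp: R_def)
  have expand: "monomial A B W x = (\<Sum>X\<in>Pow R. monomial (A \<union> X) (B \<union> (R - X)) W x)" for W x
  proof -
    have "1 = (\<Prod>e\<in>R. (case e of (u, v) \<Rightarrow> W (x u) (x v)) + (case e of (u, v) \<Rightarrow> 1 - W (x u) (x v)))"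
      by (simp add: case_prod_unfold)
    also have "\<dots> = (\<Sum>X\<in>Pow R. (\<Prod>(u, v)\<in>X. W (x u) (x v)) * (\<Prod>(u, v)\<in>R - X. 1 - W (x u) (x v)))"
      by (rule prod_add[OF fin(3)])
    finally have "monomial A B W x = monomial A B W x *
      (\<Sum>X\<in>Pow R. (\<Prod>(u, v)\<in>X. W (x u) (x v)) * (\<Prod>(u, v)\<in>R - X. 1 - W (x u) (x v)))"
      by simp
    also have "\<dots> = (\<Sum>X\<in>Pow R. monomial (A \<union> X) (B \<union> (R - X)) W x)"
      unfolding sum_distrib_left
    proof (rule sum.cong[OF refl])
      fix X assume X: "X \<in> Pow R"
      have "finite X" using X fin(3) by (auto intro: finite_subset)
      moreover have "A \<inter> X = {}" "B \<inter> (R - X) = {}" using X by (auto simp: R_def)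
      ultimately show "monomial A B W x * ((\<Prod>(u, v)\<in>X. W (x u) (x v)) * (\<Prod>(u, v)\<in>R - X. 1 - W (x u) (x v)))
        = monomial (A \<union> X) (B \<union> (R - X)) W x"
        using fin by (simp add: monomial_def prod.union_disjoint)
    qed
    finally show ?thesis .
  qed
  have "monomial_density V A B W = (\<Sum>X\<in>Pow R. monomial_density V (A \<union> X) (B \<union> (R - X)) W)"
    if "graphon W" for W
    unfolding monomial_density_def expand[of W]
    by (intro Bochner_Integration.integral_sum monomial_integrable[OF that] sub)
  moreover have "representable (\<lambda>W. \<Sum>X\<in>Pow R. monomial_density V (A \<union> X) (B \<union> (R - X)) W)"
  proof (rule representable_sum)
    fix X assume X: "X \<in> Pow R"
    then obtain H where H: "verts H = V" "edge_pairs H = A \<union> X"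
      using ex_sgraph[OF V, of "A \<union> X"] sub(1) by blast
    have "B \<union> (R - X) = vpairs V - (A \<union> X)"
      using X A B AB by (auto simp: R_def)
    then have "ind_density H = monomial_density V (A \<union> X) (B \<union> (R - X))"
      using H by (simp add: ind_density_eq fun_eq_iff)
    then show "representable (monomial_density V (A \<union> X) (B \<union> (R - X)))"
      using representable_ind_density[of H] by simp
  qed
  ultimately show ?thesis
    by (auto intro: representable_cong)
qed

lemma monomial_cong:
  assumes "A \<subseteq> vpairs V" "B \<subseteq> vpairs V" "\<And>v. v \<in> V \<Longrightarrow> x v = y v"
  shows "monomial A B W x = monomial A B W y"
proof -
  have "W (x u) (x v) = W (y u) (y v)" if "(u, v) \<in> A \<union> B" for u v
    using assms that by (auto simp: vpairs_def)
  then show ?thesis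
    unfolding monomial_def by (intro arg_cong2[of _ _ _ _ "(*)"] prod.cong) auto
qed

text \<open>Coordinates on disjoint vertex sets are independent and all pairs between
  \<open>V\<close> and \<open>V'\<close> are free, so Fubini factors the integral.\<close>

lemma monomial_density_union:
  assumes W: "graphon W" and fin: "finite V" "finite V'" and dis: "V \<inter> V' = {}"
    and A: "A \<subseteq> vpairs V" "B \<subseteq> vpairs V" and A': "A' \<subseteq> vpairs V'" "B' \<subseteq> vpairs V'"
  shows "monomial_density (V \<union> V') (A \<union> A') (B \<union> B') W = monomial_density V A B W * monomial_density V' A' B' W"
proof -
  have disp: "A \<inter> A' = {}" "B \<inter> B' = {}" using A A' dis by (auto simp: vpairs_def)
  have finp: "finite A" "finite A'" "finite B" "finite B'"
    using A A' fin by (auto intro: finite_subset[OF _ finite_vpairs])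
  have split: "monomial (A \<union> A') (B \<union> B') W z = monomial A B W z * monomial A' B' W z" for z
    using disp finp by (simp add: monomial_def prod.union_disjoint)
  have sub: "A \<union> A' \<subseteq> vpairs (V \<union> V')" "B \<union> B' \<subseteq> vpairs (V \<union> V')"
    using A A' by (auto simp: vpairs_def)
  have "monomial_density (V \<union> V') (A \<union> A') (B \<union> B') W
      = (\<integral>x. (\<integral>y. monomial (A \<union> A') (B \<union> B') W (merge V V' (x, y)) \<partial>(\<Pi>\<^sub>M u\<in>V'. unit_interval)) \<partial>(\<Pi>\<^sub>M u\<in>V. unit_interval))"
    unfolding monomial_density_def
    by (rule UIP.product_integral_fold[OF dis fin monomial_integrable[OF W sub]])
  also have "\<dots> = (\<integral>x. (\<integral>y. monomial A B W x * monomial A' B' W y \<partial>(\<Pi>\<^sub>M u\<in>V'. unit_interval)) \<partial>(\<Pi>\<^sub>M u\<in>V. unit_interval))"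
  proof -
    have "monomial (A \<union> A') (B \<union> B') W (merge V V' (x, y)) = monomial A B W x * monomial A' B' W y" for x y
    proof -
      have 1: "monomial A B W (merge V V' (x, y)) = monomial A B W x"
        using A by (rule monomial_cong) (use dis in \<open>auto simp: merge_def\<close>)
      have 2: "monomial A' B' W (merge V V' (x, y)) = monomial A' B' W y"
        using A' by (rule monomial_cong) (use dis in \<open>auto simp: merge_def\<close>)
      show ?thesis by (simp add: split 1 2)
    qed
    then show ?thesis by simp
  qed
  also have "\<dots> = monomial_density V A B W * monomial_density V' A' B' W"
    by (simp add: monomial_density_def)
  finally show ?thesis .
qed

text \<open>Relabelling coordinates preserves the product measure. Translation also preserves the
  order of each pair, and it serves to make two vertex sets disjoint.\<close>

lemma monomial_density_shift:
  fixes k :: nat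
  assumes W: "graphon W" and fin: "finite V" and A: "A \<subseteq> vpairs V" "B \<subseteq> vpairs V"
  defines "s \<equiv> map_prod ((+) k) ((+) k)"
  shows "monomial_density ((+) k ` V) (s ` A) (s ` B) W = monomial_density V A B W"
proof -
  let ?N = "\<Pi>\<^sub>M u\<in>(+) k ` V. unit_interval" and ?M = "\<Pi>\<^sub>M u\<in>V. unit_interval"
  let ?t = "\<lambda>\<omega>. \<lambda>n\<in>V. \<omega> (k + n)"
  have M: "?M = distr ?N ?M ?t"
    using distr_PiM_reindex[of "(+) k ` V" "\<lambda>_. unit_interval" "(+) k" V]
    by (simp add: prob_space_unit_interval)
  have t: "?t \<in> measurable ?N ?M"
    by (intro measurable_restrict measurable_component_singleton) auto
  have inj: "inj_on s X" for X by (auto simp: s_def inj_on_def)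
  have "monomial_density V A B W = (\<integral>x. monomial A B W x \<partial>distr ?N ?M ?t)"
    unfolding monomial_density_def using M by simp
  also have "\<dots> = (\<integral>\<omega>. monomial A B W (?t \<omega>) \<partial>?N)"
    by (rule integral_distr[OF t]) (rule monomial_measurable[OF W A])
  also have "\<dots> = (\<integral>\<omega>. monomial (s ` A) (s ` B) W \<omega> \<partial>?N)"
  proof -
    have "monomial A B W (?t \<omega>) = monomial (s ` A) (s ` B) W \<omega>" for \<omega>
    proof -
      have "monomial A B W (?t \<omega>) = monomial A B W (\<lambda>n. \<omega> (k + n))"
        by (rule monomial_cong[OF A]) auto
      also have "\<dots> = monomial (s ` A) (s ` B) W \<omega>"
        unfolding monomial_def
        by (subst (1 2) prod.reindex[OF inj]) (simp add: s_def case_prod_unfold)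
      finally show ?thesis .
    qed
    then show ?thesis by simp
  qed
  finally show ?thesis by (simp add: monomial_density_def)
qed

text \<open>The product is the density of the disjoint union of \<open>H\<close> and a translate of
  \<open>H'\<close>, with every cross pair left free.\<close>

lemma representable_mult_ind:
  "representable (\<lambda>W. ind_density H W * ind_density H' W)"
proof -
  define k where "k = Suc (Max (insert 0 (verts H)))"
  have k: "v < k" if "v \<in> verts H" for v
    unfolding k_def less_Suc_eq_le by (rule Max_ge) (use that in auto)
  define s where "s = map_prod ((+) k) ((+) k)"
  let ?V = "verts H" and ?V' = "(+) k ` verts H'"
  let ?A = "edge_pairs H" and ?A' = "s ` edge_pairs H'"
  let ?B = "vpairs (verts H) - edge_pairs H" and ?B' = "s ` (vpairs (verts H') - edge_pairs H')"
  have dis: "?V \<inter> ?V' = {}" using k by fastforce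
  have A: "?A \<subseteq> vpairs ?V" "?B \<subseteq> vpairs ?V" using edge_pairs_subset by auto
  have s: "s ` X \<subseteq> vpairs ?V'" if "X \<subseteq> vpairs (verts H')" for X
    using that by (auto simp: s_def vpairs_def)
  have A': "?A' \<subseteq> vpairs ?V'" "?B' \<subseteq> vpairs ?V'"
    by (intro s edge_pairs_subset Diff_subset)+
  have "inj s" by (auto simp: s_def inj_def)
  then have "?A' \<inter> ?B' = {}" by (simp flip: image_Int)
  moreover have "vpairs ?V \<inter> vpairs ?V' = {}" using dis by (auto simp: vpairs_def)
  ultimately have "(?A \<union> ?A') \<inter> (?B \<union> ?B') = {}" using A A' by blast
  moreover have "?A \<union> ?A' \<subseteq> vpairs (?V \<union> ?V')" "?B \<union> ?B' \<subseteq> vpairs (?V \<union> ?V')"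
    using A A' by (auto simp: vpairs_def)
  ultimately have "representable (monomial_density (?V \<union> ?V') (?A \<union> ?A') (?B \<union> ?B'))"
    by (intro representable_monomial_density) auto
  then show ?thesis
  proof (rule representable_cong)
    fix W assume W: "graphon W"
    have "monomial_density (?V \<union> ?V') (?A \<union> ?A') (?B \<union> ?B') W
        = monomial_density ?V ?A ?B W * monomial_density ?V' ?A' ?B' W"
      by (rule monomial_density_union[OF W _ _ dis A A']) auto
    also have "monomial_density ?V' ?A' ?B' W = ind_density H' W"
      unfolding s_def ind_density_eq by (rule monomial_density_shift[OF W]) (auto simp: edge_pairs_subset)
    finally show "monomial_density (?V \<union> ?V') (?A \<union> ?A') (?B \<union> ?B') W = ind_density H W * ind_density H' W"
      by (simp add: ind_density_eq)
  qed
qed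

lemma representable_mult:
  assumes "representable \<phi>" "representable \<psi>"
  shows "representable (\<lambda>W. \<phi> W * \<psi> W)"
proof -
  obtain f g where fg: "\<And>W. graphon W \<Longrightarrow> q_density f W = \<phi> W" "\<And>W. graphon W \<Longrightarrow> q_density g W = \<psi> W"
    using assms unfolding representable_def by blast
  let ?c = "\<lambda>H H'. Poly_Mapping.lookup f H * Poly_Mapping.lookup g H'"
  have "representable (\<lambda>W. \<Sum>H\<in>Poly_Mapping.keys f. \<Sum>H'\<in>Poly_Mapping.keys g.
      ?c H H' * (ind_density H W * ind_density H' W))"
    by (intro representable_sum representable_scale representable_mult_ind)
  then show ?thesis
  proof (rule representable_cong)
    fix W assume "graphon W"
    then have "\<phi> W * \<psi> W = q_density f W * q_density g W" by (simp add: fg)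
    then show "(\<Sum>H\<in>Poly_Mapping.keys f. \<Sum>H'\<in>Poly_Mapping.keys g.
      ?c H H' * (ind_density H W * ind_density H' W)) = \<phi> W * \<psi> W"
      by (simp add: q_density_def sum_product mult_ac)
  qed
qed

lemma representable_const: "representable (\<lambda>W. c)"
proof -
  have "representable (monomial_density {} {} {})"
    by (rule representable_monomial_density) auto
  then have "representable (\<lambda>W. c * monomial_density {} {} {} W)"
    by (rule representable_scale)
  moreover have "monomial_density {} {} {} W = 1" for W
    using prob_space.prob_space[OF prob_space_cube, of "{}"]
    by (simp add: monomial_density_def monomial_def)
  ultimately show ?thesis by simp
qed

lemma representable_power: "representable \<phi> \<Longrightarrow> representable (\<lambda>W. \<phi> W ^ n)"
  by (induction n) (auto intro: representable_const representable_mult)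

section \<open>Degrees in the complement, and densities rooted at a vertex\<close>

definition codegree :: "(real \<Rightarrow> real \<Rightarrow> real) \<Rightarrow> real \<Rightarrow> real" where
  "codegree W x = (\<integral>y. 1 - W x y \<partial>unit_interval)"

lemma graphon_section_measurable:
  assumes "graphon W" "x \<in> {0..1}"
  shows "W x \<in> borel_measurable unit_interval"
  by (rule graphon_measurable2[OF assms(1)]) (use assms(2) in \<open>auto intro: measurable_const\<close>)

lemma graphon_section_integrable:
  assumes "graphon W" "x \<in> {0..1}"
  shows "integrable unit_interval (\<lambda>y. 1 - W x y)"
  using graphonD(2,3)[OF assms(1)] assms graphon_section_measurable[OF assms]
  by (intro integrable_bounded_prob[where B = 1] prob_space_unit_interval) auto

lemma codegree_measurable:
  assumes "graphon W"
  shows "codegree W \<in> borel_measurable unit_interval"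
proof -
  have [measurable]: "case_prod W \<in> borel_measurable (unit_interval \<Otimes>\<^sub>M unit_interval)"
    by (rule graphonD[OF assms])
  show ?thesis unfolding codegree_def by measurable
qed

lemma codegree_bounds:
  assumes "graphon W" "x \<in> {0..1}"
  shows "0 \<le> codegree W x" "codegree W x \<le> 1"
proof -
  show "0 \<le> codegree W x" unfolding codegree_def
    using graphonD(3)[OF assms(1)] assms(2) by (intro integral_nonneg_AE AE_I2) auto
  have "codegree W x \<le> (\<integral>y. 1 \<partial>unit_interval)" unfolding codegree_def
    using graphonD(2)[OF assms(1)] assms
    by (intro integral_mono graphon_section_integrable) auto
  then show "codegree W x \<le> 1" using UI.prob_space by simp
qed

lemma codegree_power_integrable:
  assumes "graphon W"
  shows "integrable unit_interval (\<lambda>x. codegree W x ^ k)"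
  using codegree_bounds[OF assms] codegree_measurable[OF assms]
  by (intro integrable_bounded_prob[where B = 1] prob_space_unit_interval)
     (auto simp: power_le_one)

lemma monomial_codegree_integrable:
  assumes "graphon W" "A \<subseteq> vpairs I" "B \<subseteq> vpairs I" "r \<in> I"
  shows "integrable (\<Pi>\<^sub>M u\<in>I. unit_interval) (\<lambda>x. monomial A B W x * codegree W (x r) ^ k)"
proof (intro integrable_bounded_prob[where B = 1] prob_space_cube)
  have [measurable]: "monomial A B W \<in> borel_measurable (\<Pi>\<^sub>M u\<in>I. unit_interval)"
    by (rule monomial_measurable[OF assms(1-3)])
  have [measurable]: "(\<lambda>x. codegree W (x r)) \<in> borel_measurable (\<Pi>\<^sub>M u\<in>I. unit_interval)"
    using assms by (intro measurable_compose[of "\<lambda>x. x r" _ unit_interval "codegree W" borel]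
      measurable_component_singleton codegree_measurable)
  show "(\<lambda>x. monomial A B W x * codegree W (x r) ^ k) \<in> borel_measurable (\<Pi>\<^sub>M u\<in>I. unit_interval)"
    by measurable
  fix x assume x: "x \<in> space (\<Pi>\<^sub>M u\<in>I. unit_interval)"
  then have "x r \<in> {0..1}" "x \<in> I \<rightarrow> {0..1}" using assms(4) by (auto simp: space_PiM)
  then show "\<bar>monomial A B W x * codegree W (x r) ^ k\<bar> \<le> 1"
    using monomial_bounds[OF assms(1-3)] codegree_bounds[OF assms(1)]
    by (auto simp: abs_mult intro!: mult_le_one power_le_one)
qed

text \<open>Given \<open>x r\<close>, the vertices of \<open>J\<close> are independent and each
  contributes the factor \<open>codegree W (x r)\<close>; integrating them out leaves the power. The
  condition \<open>r < j\<close> matches the orientation of pairs in \<open>vpairs\<close>.\<close>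

lemma monomial_density_pendant:
  assumes W: "graphon W" and fin: "finite I" "finite J" and dis: "I \<inter> J = {}"
    and r: "r \<in> I" "\<And>j. j \<in> J \<Longrightarrow> r < j" and A: "A \<subseteq> vpairs I" "B \<subseteq> vpairs I"
  shows "monomial_density (I \<union> J) A (B \<union> {r} \<times> J) W
    = (\<integral>x. monomial A B W x * codegree W (x r) ^ card J \<partial>(\<Pi>\<^sub>M u\<in>I. unit_interval))"
proof -
  let ?I = "\<Pi>\<^sub>M u\<in>I. unit_interval" and ?J = "\<Pi>\<^sub>M u\<in>J. unit_interval"
  have sub: "A \<subseteq> vpairs (I \<union> J)" "B \<union> {r} \<times> J \<subseteq> vpairs (I \<union> J)"
    using A r by (auto simp: vpairs_def)
  have finB: "finite B" using A(2) fin by (auto intro: finite_subset[OF _ finite_vpairs])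
  have disB: "B \<inter> {r} \<times> J = {}" using A(2) dis by (auto simp: vpairs_def)
  have split: "monomial A (B \<union> {r} \<times> J) W (merge I J (x, y)) = monomial A B W x * (\<Prod>j\<in>J. 1 - W (x r) (y j))" for x y
  proof -
    have eq: "monomial A B W (merge I J (x, y)) = monomial A B W x"
      using A by (rule monomial_cong) (use dis in \<open>auto simp: merge_def\<close>)
    have "monomial A (B \<union> {r} \<times> J) W z = monomial A B W z * (\<Prod>j\<in>J. 1 - W (z r) (z j))" for z
    proof -
      have "(\<Prod>(u, v)\<in>{r} \<times> J. 1 - W (z u) (z v)) = (\<Prod>j\<in>J. 1 - W (z r) (z j))"
        by (subst prod.cartesian_product[symmetric]) simp
      then show ?thesis using finB disB fin by (simp add: monomial_def prod.union_disjoint)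
    qed
    also have "(\<Prod>j\<in>J. 1 - W (merge I J (x, y) r) (merge I J (x, y) j)) = (\<Prod>j\<in>J. 1 - W (x r) (y j))"
      by (rule prod.cong) (use dis r in \<open>auto simp: merge_def\<close>)
    finally show ?thesis unfolding eq .
  qed
  have "monomial_density (I \<union> J) A (B \<union> {r} \<times> J) W
      = (\<integral>x. (\<integral>y. monomial A (B \<union> {r} \<times> J) W (merge I J (x, y)) \<partial>?J) \<partial>?I)"
    unfolding monomial_density_def
    by (rule UIP.product_integral_fold[OF dis fin monomial_integrable[OF W sub]])
  also have "\<dots> = (\<integral>x. monomial A B W x * codegree W (x r) ^ card J \<partial>?I)"
  proof (rule Bochner_Integration.integral_cong[OF refl])
    fix x assume "x \<in> space ?I"
    then have xr: "x r \<in> {0..1}" using r by (auto simp: space_PiM PiE_iff)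
    have "(\<integral>y. (\<Prod>j\<in>J. 1 - W (x r) (y j)) \<partial>?J) = (\<Prod>j\<in>J. \<integral>t. 1 - W (x r) t \<partial>unit_interval)"
      by (intro UIP.product_integral_prod fin graphon_section_integrable W xr)
    then show "(\<integral>y. monomial A (B \<union> {r} \<times> J) W (merge I J (x, y)) \<partial>?J)
        = monomial A B W x * codegree W (x r) ^ card J"
      by (simp add: split codegree_def)
  qed
  finally show ?thesis .
qed

lemma representable_monomial_codegree:
  assumes "finite I" "r \<in> I" "A \<subseteq> vpairs I" "B \<subseteq> vpairs I" "A \<inter> B = {}"
  shows "representable (\<lambda>W. \<integral>x. monomial A B W x * codegree W (x r) ^ k \<partial>(\<Pi>\<^sub>M u\<in>I. unit_interval))"
proof -
  define m where "m = Suc (Max I)"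
  have m: "i < m" if "i \<in> I" for i
    unfolding m_def less_Suc_eq_le by (rule Max_ge) (use that assms in auto)
  \<comment> \<open>These are \<open>k\<close> fresh vertices above all of \<open>I\<close>, so that
    each new pair has \<open>r\<close> as its smaller member.\<close>
  define J where "J = {m..<m + k}"
  have J: "finite J" "I \<inter> J = {}" "\<And>j. j \<in> J \<Longrightarrow> r < j" "card J = k"
    using m assms(2) by (fastforce simp: J_def)+
  have "representable (monomial_density (I \<union> J) A (B \<union> {r} \<times> J))"
  proof (rule representable_monomial_density)
    show "A \<subseteq> vpairs (I \<union> J)" "B \<union> {r} \<times> J \<subseteq> vpairs (I \<union> J)"
      using assms J by (auto simp: vpairs_def)
    show "A \<inter> (B \<union> {r} \<times> J) = {}" using assms J by (auto simp: vpairs_def)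
  qed (use assms J in auto)
  then show ?thesis
    by (rule representable_cong)
       (use monomial_density_pendant[OF _ assms(1) J(1-2) assms(2) J(3) assms(3,4)] J(4) in auto)
qed

lemma representable_moment: "representable (\<lambda>W. \<integral>x. codegree W x ^ k \<partial>unit_interval)"
proof -
  have "representable (\<lambda>W. \<integral>x. monomial {} {} W x * codegree W (x 0) ^ k \<partial>(\<Pi>\<^sub>M u\<in>{0}. unit_interval))"
    by (rule representable_monomial_codegree) auto
  then show ?thesis
  proof (rule representable_cong)
    fix W assume "graphon W"
    then show "(\<integral>x. monomial {} {} W x * codegree W (x 0) ^ k \<partial>(\<Pi>\<^sub>M u\<in>{0}. unit_interval))
        = (\<integral>x. codegree W x ^ k \<partial>unit_interval)"
      using UIP.product_integral_singleton[of "\<lambda>t. codegree W t ^ k" 0] codegree_measurable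
      by (simp add: monomial_def)
  qed
qed

text \<open>Expanding the square leaves moments of order up to \<open>2 * n\<close>. The
  coefficients may depend on \<open>W\<close>, because products of representable functionals are
  representable.\<close>

lemma representable_square_moment:
  assumes "\<And>k. representable (a k)"
  shows "representable (\<lambda>W. \<integral>x. (\<Sum>k\<le>n. a k W * codegree W x ^ k)\<^sup>2 \<partial>unit_interval)"
proof -
  have "representable (\<lambda>W. \<Sum>i\<le>n. \<Sum>j\<le>n. a i W * a j W * (\<integral>x. codegree W x ^ (i + j) \<partial>unit_interval))"
    by (intro representable_sum representable_mult representable_moment assms)
  then show ?thesis
  proof (rule representable_cong)
    fix W assume W: "graphon W"
    have "(\<integral>x. (\<Sum>k\<le>n. a k W * codegree W x ^ k)\<^sup>2 \<partial>unit_interval)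
        = (\<integral>x. (\<Sum>i\<le>n. \<Sum>j\<le>n. a i W * a j W * codegree W x ^ (i + j)) \<partial>unit_interval)"
      by (simp add: power2_eq_square sum_product power_add mult_ac)
    also have "\<dots> = (\<Sum>i\<le>n. \<Sum>j\<le>n. \<integral>x. a i W * a j W * codegree W x ^ (i + j) \<partial>unit_interval)"
      by (subst Bochner_Integration.integral_sum, force intro!: codegree_power_integrable[OF W])
         (subst Bochner_Integration.integral_sum, auto intro!: codegree_power_integrable[OF W])
    finally show "(\<Sum>i\<le>n. \<Sum>j\<le>n. a i W * a j W * (\<integral>x. codegree W x ^ (i + j) \<partial>unit_interval))
        = (\<integral>x. (\<Sum>k\<le>n. a k W * codegree W x ^ k)\<^sup>2 \<partial>unit_interval)"
      by simp
  qed
qed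

lemma ind_density_K2:
  assumes W: "graphon W"
  shows "ind_density K2 W = 1 - (\<integral>x. codegree W x \<partial>unit_interval)"
proof -
  let ?M = "\<Pi>\<^sub>M u\<in>{0, 1::nat}. unit_interval"
  have v: "verts K2 = {0, 1}" "edges K2 = {{0, 1}}" by (transfer, simp)+
  then have e: "edge_pairs K2 = {(0, 1)}" by (auto simp: edge_pairs_def)
  have vp: "vpairs {0, 1} = {(0, 1)}" by (auto simp: vpairs_def)
  have "monomial_density ({0} \<union> {1}) {} ({} \<union> {0} \<times> {1}) W = (\<integral>x. codegree W (x 0) \<partial>(\<Pi>\<^sub>M u\<in>{0::nat}. unit_interval))"
    by (subst monomial_density_pendant[OF W]) (auto simp: monomial_def)
  also have "\<dots> = (\<integral>x. codegree W x \<partial>unit_interval)"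
    by (rule UIP.product_integral_singleton[OF codegree_measurable[OF W]])
  finally have 1: "monomial_density {0, 1} {} {(0, 1)} W = (\<integral>x. codegree W x \<partial>unit_interval)"
    by (simp add: insert_commute)
  have "ind_density K2 W = (\<integral>x. 1 - monomial {} {(0, 1)} W x \<partial>?M)"
  proof -
    have "monomial {(0, 1)} {} W = (\<lambda>x. 1 - monomial {} {(0, 1)} W x)"
      by (simp add: monomial_def fun_eq_iff)
    then show ?thesis unfolding ind_density_eq v e vp monomial_density_def by simp
  qed
  also have "\<dots> = (\<integral>x. 1 \<partial>?M) - (\<integral>x. monomial {} {(0, 1)} W x \<partial>?M)"
  proof (rule Bochner_Integration.integral_diff)
    show "integrable ?M (\<lambda>x. 1 :: real)"
      by (rule integrable_bounded_prob[OF prob_space_cube]) auto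
    show "integrable ?M (monomial {} {(0, 1)} W)"
      by (rule monomial_integrable[OF W]) (simp_all only: vp, auto)
  qed
  also have "\<dots> = 1 - (\<integral>x. codegree W x \<partial>unit_interval)"
    using prob_space.prob_space[OF prob_space_cube[of "{0, Suc 0}"]] 1
    by (simp add: monomial_density_def)
  finally show ?thesis .
qed

text \<open>The summands are the induced complement paths centred at \<open>x\<close> and at
  \<open>y\<close>. The one centred at \<open>z\<close> arises from the second by exchanging
  \<open>y\<close> and \<open>z\<close>, so integration over both variables covers it.\<close>

definition cherry :: "(real \<Rightarrow> real \<Rightarrow> real) \<Rightarrow> real \<Rightarrow> real \<Rightarrow> real \<Rightarrow> real" where
  "cherry W x y z = (1 - W x y) * (1 - W x z) * W y z + (1 - W x y) * (1 - W y z) * W x z"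

text \<open>The weight exempts exactly the roots of codegree \<beta>; as a polynomial in the
  codegree it keeps the functional representable.\<close>

definition cherry_density :: "real \<Rightarrow> (real \<Rightarrow> real \<Rightarrow> real) \<Rightarrow> real" where
  "cherry_density \<beta> W = (\<integral>x. (codegree W (x 0) - \<beta>)\<^sup>2 * cherry W (x 0) (x 1) (x 2)
     \<partial>(\<Pi>\<^sub>M u\<in>{0, 1, 2::nat}. unit_interval))"

lemma cherry_eq_monomial:
  "cherry W (x 0) (x 1) (x 2) = monomial {(1, 2)} {(0, 1), (0, 2)} W x + monomial {(0, 2)} {(0, 1), (1, 2)} W x"
  by (simp add: cherry_def monomial_def mult_ac)

lemma representable_cherry_density: "representable (cherry_density \<beta>)"
proof -
  let ?M = "\<Pi>\<^sub>M u\<in>{0, 1, 2::nat}. unit_interval"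
  let ?T = "\<lambda>A B k W x. monomial A B W x * codegree W (x 0) ^ k"
  have sub: "{(1, 2)} \<subseteq> vpairs {0, 1, 2}" "{(0, 1), (0, 2)} \<subseteq> vpairs {0, 1, 2}"
    "{(0, 2)} \<subseteq> vpairs {0, 1, 2}" "{(0, 1), (1, 2)} \<subseteq> vpairs {0, 1, 2}"
    by (auto simp: vpairs_def)
  have rep: "representable (\<lambda>W. (\<integral>x. ?T A B 2 W x \<partial>?M) - 2 * \<beta> * (\<integral>x. ?T A B 1 W x \<partial>?M)
      + \<beta>\<^sup>2 * (\<integral>x. ?T A B 0 W x \<partial>?M))"
    if "A \<subseteq> vpairs {0, 1, 2}" "B \<subseteq> vpairs {0, 1, 2}" "A \<inter> B = {}" for A B
    using that
    by (intro representable_add representable_diff representable_scale representable_monomial_codegree) auto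
  have eq: "integrable ?M (\<lambda>x. (codegree W (x 0) - \<beta>)\<^sup>2 * monomial A B W x) \<and>
     (\<integral>x. (codegree W (x 0) - \<beta>)\<^sup>2 * monomial A B W x \<partial>?M) =
     (\<integral>x. ?T A B 2 W x \<partial>?M) - 2 * \<beta> * (\<integral>x. ?T A B 1 W x \<partial>?M)
      + \<beta>\<^sup>2 * (\<integral>x. ?T A B 0 W x \<partial>?M)"
    if "graphon W" "A \<subseteq> vpairs {0, 1, 2}" "B \<subseteq> vpairs {0, 1, 2}" for A B W
  proof -
    have int: "integrable ?M (?T A B k W)" for k
      using that by (intro monomial_codegree_integrable) auto
    have "(\<lambda>x. (codegree W (x 0) - \<beta>)\<^sup>2 * monomial A B W x)
        = (\<lambda>x. ?T A B 2 W x - 2 * \<beta> * ?T A B 1 W x + \<beta>\<^sup>2 * ?T A B 0 W x)"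
      by (auto simp: fun_eq_iff power2_eq_square algebra_simps)
    then show ?thesis
      using int[of 0] int[of 1] int[of 2] by simp
  qed
  have "representable (\<lambda>W.
      ((\<integral>x. ?T {(1, 2)} {(0, 1), (0, 2)} 2 W x \<partial>?M) - 2 * \<beta> * (\<integral>x. ?T {(1, 2)} {(0, 1), (0, 2)} 1 W x \<partial>?M)
       + \<beta>\<^sup>2 * (\<integral>x. ?T {(1, 2)} {(0, 1), (0, 2)} 0 W x \<partial>?M)) +
      ((\<integral>x. ?T {(0, 2)} {(0, 1), (1, 2)} 2 W x \<partial>?M) - 2 * \<beta> * (\<integral>x. ?T {(0, 2)} {(0, 1), (1, 2)} 1 W x \<partial>?M)
       + \<beta>\<^sup>2 * (\<integral>x. ?T {(0, 2)} {(0, 1), (1, 2)} 0 W x \<partial>?M)))"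
    by (intro representable_add rep sub) auto
  then show ?thesis
  proof (rule representable_cong)
    fix W assume W: "graphon W"
    note 1 = eq[OF W sub(1,2)] and 2 = eq[OF W sub(3,4)]
    show "((\<integral>x. ?T {(1, 2)} {(0, 1), (0, 2)} 2 W x \<partial>?M) - 2 * \<beta> * (\<integral>x. ?T {(1, 2)} {(0, 1), (0, 2)} 1 W x \<partial>?M)
       + \<beta>\<^sup>2 * (\<integral>x. ?T {(1, 2)} {(0, 1), (0, 2)} 0 W x \<partial>?M)) +
      ((\<integral>x. ?T {(0, 2)} {(0, 1), (1, 2)} 2 W x \<partial>?M) - 2 * \<beta> * (\<integral>x. ?T {(0, 2)} {(0, 1), (1, 2)} 1 W x \<partial>?M)
       + \<beta>\<^sup>2 * (\<integral>x. ?T {(0, 2)} {(0, 1), (1, 2)} 0 W x \<partial>?M)) = cherry_density \<beta> W"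
      unfolding cherry_density_def cherry_eq_monomial distrib_left
      using 1 2 by (subst Bochner_Integration.integral_add) auto
  qed
qed

lemma nn_integral_cube3:
  assumes [measurable]: "(\<lambda>(x, y, z). h x y z) \<in> borel_measurable (unit_interval \<Otimes>\<^sub>M (unit_interval \<Otimes>\<^sub>M unit_interval))"
  shows "(\<integral>\<^sup>+\<omega>. h (\<omega> 0) (\<omega> 1) (\<omega> 2) \<partial>(\<Pi>\<^sub>M u\<in>{0, 1, 2::nat}. unit_interval))
    = (\<integral>\<^sup>+x. \<integral>\<^sup>+y. \<integral>\<^sup>+z. h x y z \<partial>unit_interval \<partial>unit_interval \<partial>unit_interval)"
proof -
  have [measurable]: "(\<lambda>\<omega>. \<omega> i) \<in> measurable (\<Pi>\<^sub>M u\<in>I. unit_interval) unit_interval" if "i \<in> I" for i and I :: "nat set"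
    using that by (rule measurable_component_singleton)
  have m: "(\<lambda>\<omega>. h (\<omega> 0) (\<omega> 1) (\<omega> 2)) \<in> borel_measurable (\<Pi>\<^sub>M u\<in>insert 2 {0, 1::nat}. unit_interval)"
  proof -
    have "(\<lambda>\<omega>. (\<lambda>(x, y, z). h x y z) (\<omega> 0, \<omega> 1, \<omega> 2)) \<in> borel_measurable (\<Pi>\<^sub>M u\<in>insert 2 {0, 1::nat}. unit_interval)"
      by measurable
    then show ?thesis by simp
  qed
  have "(\<integral>\<^sup>+\<omega>. h (\<omega> 0) (\<omega> 1) (\<omega> 2) \<partial>(\<Pi>\<^sub>M u\<in>{0, 1, 2::nat}. unit_interval))
      = (\<integral>\<^sup>+\<omega>. h (\<omega> 0) (\<omega> 1) (\<omega> 2) \<partial>(\<Pi>\<^sub>M u\<in>insert 2 {0, 1::nat}. unit_interval))"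
    by (simp add: insert_commute)
  also have "\<dots> = (\<integral>\<^sup>+\<omega>. \<integral>\<^sup>+z. h (\<omega> 0) (\<omega> 1) z \<partial>unit_interval \<partial>(\<Pi>\<^sub>M u\<in>{0, 1::nat}. unit_interval))"
    by (subst UIP.product_nn_integral_insert[OF _ _ m]) auto
  also have "\<dots> = (\<integral>\<^sup>+\<omega>. \<integral>\<^sup>+z. h (\<omega> 0) (\<omega> 1) z \<partial>unit_interval \<partial>(\<Pi>\<^sub>M u\<in>insert 1 {0::nat}. unit_interval))"
    by (simp add: insert_commute)
  also have "\<dots> = (\<integral>\<^sup>+\<omega>. \<integral>\<^sup>+y. \<integral>\<^sup>+z. h (\<omega> 0) y z \<partial>unit_interval \<partial>unit_interval \<partial>(\<Pi>\<^sub>M u\<in>{0::nat}. unit_interval))"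
  proof (subst UIP.product_nn_integral_insert)
    have "(\<lambda>\<omega>. \<integral>\<^sup>+z. (\<lambda>(x, y, z). h x y z) (\<omega> 0, \<omega> 1, z) \<partial>unit_interval) \<in> borel_measurable (\<Pi>\<^sub>M u\<in>insert 1 {0::nat}. unit_interval)"
      by measurable
    then show "(\<lambda>\<omega>. \<integral>\<^sup>+z. h (\<omega> 0) (\<omega> 1) z \<partial>unit_interval) \<in> borel_measurable (\<Pi>\<^sub>M u\<in>insert 1 {0::nat}. unit_interval)"
      by simp
  qed auto
  also have "\<dots> = (\<integral>\<^sup>+x. \<integral>\<^sup>+y. \<integral>\<^sup>+z. h x y z \<partial>unit_interval \<partial>unit_interval \<partial>unit_interval)"
  proof (rule UIP.product_nn_integral_singleton)
    have "(\<lambda>x. \<integral>\<^sup>+y. \<integral>\<^sup>+z. (\<lambda>(x, y, z). h x y z) (x, y, z) \<partial>unit_interval \<partial>unit_interval) \<in> borel_measurable unit_interval"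
      by measurable
    then show "(\<lambda>x. \<integral>\<^sup>+y. \<integral>\<^sup>+z. h x y z \<partial>unit_interval \<partial>unit_interval) \<in> borel_measurable unit_interval"
      by simp
  qed
  finally show ?thesis .
qed

lemma cherry_nonneg:
  assumes "graphon W" "x \<in> {0..1}" "y \<in> {0..1}" "z \<in> {0..1}"
  shows "0 \<le> cherry W x y z"
  using graphonD(2,3)[OF assms(1)] assms(2-) unfolding cherry_def by auto

lemma cherry_density_nonneg:
  assumes "graphon W" shows "0 \<le> cherry_density \<beta> W"
  unfolding cherry_density_def
  by (intro integral_nonneg_AE AE_I2 mult_nonneg_nonneg zero_le_power2 cherry_nonneg[OF assms])
     (auto simp: space_PiM PiE_iff)

text \<open>A nonnegative integrand with integral zero vanishes almost everywhere. Tonelli gives the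
  nested form, which allows one root \<open>x\<close> to be fixed and studied alone.\<close>

lemma cherry_density_zeroD:
  assumes W: "graphon W" and 0: "cherry_density \<beta> W = 0"
  shows "AE x in unit_interval. codegree W x \<noteq> \<beta> \<longrightarrow>
    (AE y in unit_interval. AE z in unit_interval. cherry W x y z = 0)"
proof -
  let ?h = "\<lambda>x y z. (codegree W x - \<beta>)\<^sup>2 * cherry W x y z"
  let ?M = "\<Pi>\<^sub>M u\<in>{0, 1, 2::nat}. unit_interval"
  have [measurable]: "case_prod W \<in> borel_measurable (unit_interval \<Otimes>\<^sub>M unit_interval)"
    "codegree W \<in> borel_measurable unit_interval"
    using W by (simp_all add: graphonD codegree_measurable)
  have hm[measurable]: "(\<lambda>(x, y, z). ?h x y z) \<in> borel_measurable (unit_interval \<Otimes>\<^sub>M (unit_interval \<Otimes>\<^sub>M unit_interval))"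
    unfolding cherry_def by measurable
  have hm2: "(\<lambda>(x, y). \<integral>\<^sup>+z. ennreal (?h x y z) \<partial>unit_interval) \<in> borel_measurable (unit_interval \<Otimes>\<^sub>M unit_interval)"
    unfolding cherry_def by measurable
  have nonneg: "0 \<le> ?h x y z" if "x \<in> {0..1}" "y \<in> {0..1}" "z \<in> {0..1}" for x y z
    using cherry_nonneg[OF W that] by simp
  have int: "integrable ?M (\<lambda>x. ?h (x 0) (x 1) (x 2))"
  proof (rule integrable_bounded_prob[OF prob_space_cube])
    have c: "(\<lambda>\<omega>. \<omega> i) \<in> measurable ?M unit_interval" if "i \<in> {0, 1, 2}" for i
      using that by (rule measurable_component_singleton)
    have [measurable]: "(\<lambda>\<omega>. \<omega> 0) \<in> measurable ?M unit_interval"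
      "(\<lambda>\<omega>. \<omega> 1) \<in> measurable ?M unit_interval" "(\<lambda>\<omega>. \<omega> 2) \<in> measurable ?M unit_interval"
      by (auto intro: c)
    have "(\<lambda>\<omega>. (\<lambda>(x, y, z). ?h x y z) (\<omega> 0, \<omega> 1, \<omega> 2)) \<in> borel_measurable ?M"
      by measurable
    then show "(\<lambda>x. ?h (x 0) (x 1) (x 2)) \<in> borel_measurable ?M" by simp
    fix x assume "x \<in> space ?M"
    then have x: "x 0 \<in> {0..1}" "x 1 \<in> {0..1}" "x 2 \<in> {0..1}" by (auto simp: space_PiM PiE_iff)
    have "\<bar>codegree W (x 0) - \<beta>\<bar> \<le> \<bar>1 + \<bar>\<beta>\<bar>\<bar>"
      using codegree_bounds[OF W x(1)] by linarith
    then have "(codegree W (x 0) - \<beta>)\<^sup>2 \<le> (1 + \<bar>\<beta>\<bar>)\<^sup>2"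
      by (simp only: abs_le_square_iff)
    moreover have "cherry W (x 0) (x 1) (x 2) \<le> 1 + 1"
      unfolding cherry_def using graphonD(2,3)[OF W] x
      by (intro add_mono mult_le_one) auto
    ultimately show "\<bar>?h (x 0) (x 1) (x 2)\<bar> \<le> (1 + \<bar>\<beta>\<bar>)\<^sup>2 * (1 + 1)"
      using cherry_nonneg[OF W x] by (simp add: abs_mult mult_mono)
  qed
  have "(\<integral>\<^sup>+x. \<integral>\<^sup>+y. \<integral>\<^sup>+z. ennreal (?h x y z) \<partial>unit_interval \<partial>unit_interval \<partial>unit_interval)
      = (\<integral>\<^sup>+\<omega>. ennreal (?h (\<omega> 0) (\<omega> 1) (\<omega> 2)) \<partial>?M)"
    by (rule nn_integral_cube3[symmetric]) (unfold cherry_def, measurable)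
  also have "\<dots> = ennreal (cherry_density \<beta> W)"
    unfolding cherry_density_def
    by (rule nn_integral_eq_integral[OF int], rule AE_I2, rule nonneg) (auto simp: space_PiM PiE_iff)
  finally have "(\<integral>\<^sup>+x. \<integral>\<^sup>+y. \<integral>\<^sup>+z. ennreal (?h x y z) \<partial>unit_interval \<partial>unit_interval \<partial>unit_interval) = 0"
    by (simp add: 0)
  then have A: "AE x in unit_interval. (\<integral>\<^sup>+y. \<integral>\<^sup>+z. ennreal (?h x y z) \<partial>unit_interval \<partial>unit_interval) = 0"
    by (subst (asm) nn_integral_0_iff_AE) (unfold cherry_def, measurable)
  show ?thesis
    using A AE_space
  proof eventually_elim
    case (elim x)
    then have x: "x \<in> {0..1}" by simp
    have [measurable]: "W x \<in> borel_measurable unit_interval"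
      by (rule graphon_section_measurable[OF W x])
    have "AE y in unit_interval. (\<integral>\<^sup>+z. ennreal (?h x y z) \<partial>unit_interval) = 0"
      using elim(1) by (subst (asm) nn_integral_0_iff_AE) (unfold cherry_def, measurable)
    then have B: "AE y in unit_interval. AE z in unit_interval. ?h x y z = 0"
      using AE_space
    proof eventually_elim
      case (elim y)
      then have y: "y \<in> {0..1}" by simp
      have [measurable]: "W y \<in> borel_measurable unit_interval"
        by (rule graphon_section_measurable[OF W y])
      have "AE z in unit_interval. ennreal (?h x y z) = 0"
        using elim(1) by (subst (asm) nn_integral_0_iff_AE) (unfold cherry_def, measurable)
      then show ?case using AE_space
      proof eventually_elim
        case (elim z)
        then show ?case using nonneg[OF x y, of z] by (simp add: ennreal_eq_0_iff)
      qed
    qed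
    show ?case using B by auto
  qed
qed

section \<open>Classes of constant codegree\<close>

text \<open>The sets \<open>N x\<close>, \<open>x \<in> S\<close>, are pairwise equal or disjoint up to null sets; removing them from
  \<open>S\<close> one at a time must exhaust \<open>S\<close> exactly.\<close>

lemma (in prob_space) measure_eq_multiple_of_parts:
  fixes S :: "'a set" and N :: "'a \<Rightarrow> 'a set"
  assumes S[measurable]: "S \<in> events" and N: "\<And>x. x \<in> space M \<Longrightarrow> N x \<in> events" and \<delta>: "0 < \<delta>"
    and good: "AE x in M. x \<in> S \<longrightarrow> prob (N x) = \<delta> \<and> (AE y in M. y \<in> N x \<longrightarrow> y \<in> S) \<and>
      (AE w in M. w \<notin> N x \<longrightarrow> prob (N w \<inter> N x) = 0)"
  shows "\<exists>k::nat. prob S = real k * \<delta>"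
proof -
  \<comment> \<open>\<open>Q k T\<close> says that \<open>k\<close> parts have been collected in
    \<open>T\<close>. Its last clause is the invariant that makes the next part disjoint from
    \<open>T\<close> up to a null set.\<close>
  define Q where "Q k T \<longleftrightarrow> T \<in> events \<and> T \<subseteq> S \<and> prob T = real k * \<delta> \<and>
    (AE w in M. w \<in> S - T \<longrightarrow> prob (N w \<inter> T) = 0)" for k :: nat and T
  have step: "\<exists>T'. Q (Suc k) T'" if T: "Q k T" and less: "real k * \<delta> < prob S" for k T
  proof -
    have [measurable]: "T \<in> events" and TS: "T \<subseteq> S" and pT: "prob T = real k * \<delta>"
      using T by (auto simp: Q_def)
    have "prob (S - T) > 0"
      using less TS pT by (subst finite_measure_Diff) auto
    then have "\<not> (AE x in M. x \<notin> S - T)"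
      using prob_eq_0[of "S - T"] by auto
    moreover have "AE x in M. x \<in> S - T \<longrightarrow> x \<in> space M \<and> prob (N x \<inter> T) = 0 \<and> prob (N x) = \<delta> \<and>
        (AE y in M. y \<in> N x \<longrightarrow> y \<in> S) \<and> (AE w in M. w \<notin> N x \<longrightarrow> prob (N w \<inter> N x) = 0)"
    proof -
      have "AE w in M. w \<in> S - T \<longrightarrow> prob (N w \<inter> T) = 0" using T by (simp add: Q_def)
      then show ?thesis using good AE_space by eventually_elim auto
    qed
    \<comment> \<open>Since \<open>S - T\<close> is not null, a property that holds almost
      everywhere on it holds at some point of it.\<close>
    ultimately obtain z where z: "z \<in> space M" "prob (N z \<inter> T) = 0" "prob (N z) = \<delta>"
        "AE y in M. y \<in> N z \<longrightarrow> y \<in> S" "AE w in M. w \<notin> N z \<longrightarrow> prob (N w \<inter> N z) = 0"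
    proof -
      assume *: "\<not> (AE x in M. x \<notin> S - T)"
        "AE x in M. x \<in> S - T \<longrightarrow> x \<in> space M \<and> prob (N x \<inter> T) = 0 \<and> prob (N x) = \<delta> \<and>
        (AE y in M. y \<in> N x \<longrightarrow> y \<in> S) \<and> (AE w in M. w \<notin> N x \<longrightarrow> prob (N w \<inter> N x) = 0)"
      show thesis
      proof (rule ccontr)
        assume "\<not> thesis"
        from *(2) have "AE x in M. x \<notin> S - T"
          by (rule eventually_mono) (use that \<open>\<not> thesis\<close> in blast)
        with *(1) show False ..
      qed
    qed
    have [measurable]: "N z \<in> events" using N z(1) by simp
    define T' where "T' = T \<union> (N z \<inter> S)"
    have [measurable]: "T' \<in> events" by (simp add: T'_def)
    have "prob (N z \<inter> S) = prob (N z)"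
      by (rule finite_measure_eq_AE) (use z(4) in \<open>auto elim: eventually_mono\<close>)
    moreover have "prob (T \<inter> (N z \<inter> S)) = 0"
      using finite_measure_mono[of "T \<inter> (N z \<inter> S)" "N z \<inter> T"] z(2) measure_nonneg[of M "T \<inter> (N z \<inter> S)"]
      by auto
    ultimately have "prob T' = real (Suc k) * \<delta>"
      unfolding T'_def using pT z(3) by (subst measure_Un3) (auto simp: algebra_simps fmeasurable_eq_sets)
    moreover have "AE w in M. w \<in> S - T' \<longrightarrow> prob (N w \<inter> T') = 0"
    proof -
      have "AE w in M. w \<in> S - T \<longrightarrow> prob (N w \<inter> T) = 0" using T by (simp add: Q_def)
      then show ?thesis using z(5) AE_space
      proof eventually_elim
        case (elim w)
        show ?case
        proof
          assume w: "w \<in> S - T'"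
          have [measurable]: "N w \<in> events" using N elim by simp
          have "prob (N w \<inter> T') \<le> prob ((N w \<inter> T) \<union> (N w \<inter> N z))"
            by (rule finite_measure_mono) (auto simp: T'_def)
          also have "\<dots> \<le> prob (N w \<inter> T) + prob (N w \<inter> N z)"
            by (rule measure_Un_le) auto
          also have "\<dots> = 0" using w elim by (auto simp: T'_def)
          finally show "prob (N w \<inter> T') = 0"
            using measure_nonneg[of M "N w \<inter> T'"] by simp
        qed
      qed
    qed
    ultimately have "Q (Suc k) T'" using TS by (auto simp: Q_def T'_def)
    then show ?thesis ..
  qed
  have ex: "real k * \<delta> \<le> prob S \<Longrightarrow> \<exists>T. Q k T" for k
  proof (induction k)
    case 0
    then show ?case by (intro exI[of _ "{}"]) (simp add: Q_def)
  next
    case (Suc k)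
    then have "real k * \<delta> < prob S" using \<delta> by (simp add: algebra_simps)
    then show ?case using Suc.IH step by auto
  qed
  \<comment> \<open>\<open>K\<close> is the largest number of parts whose total measure fits into
    \<open>S\<close>. A positive remainder would admit one more part and exceed
    \<open>prob S\<close>.\<close>
  define K where "K = nat \<lfloor>prob S / \<delta>\<rfloor>"
  have "real K \<le> prob S / \<delta>" "prob S / \<delta> < real K + 1"
    using \<delta> by (auto simp: K_def)
  then have K: "real K * \<delta> \<le> prob S" "prob S < (real K + 1) * \<delta>"
    using \<delta> by (simp_all add: field_simps)
  have "\<not> real K * \<delta> < prob S"
  proof
    assume less: "real K * \<delta> < prob S"
    obtain T where "Q K T" using ex[OF K(1)] by auto
    then obtain T' where T': "Q (Suc K) T'" using step less by blast
    then have "prob T' \<le> prob S" by (intro finite_measure_mono) (auto simp: Q_def)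
    then show False using T' K(2) by (simp add: Q_def algebra_simps)
  qed
  then show ?thesis using K(1) by (intro exI[of _ K]) linarith
qed

text \<open>Both summands of \<open>cherry\<close> are nonnegative, hence both vanish. In the
  complement: two pairs of positive weight, one of them \<open>x y\<close>, force weight 1 on the
  third pair.\<close>

lemma cherry_zeroD:
  assumes W: "graphon W" and xyz: "x \<in> {0..1}" "y \<in> {0..1}" "z \<in> {0..1}" and 0: "cherry W x y z = 0"
  shows "W x y < 1 \<Longrightarrow> W x z < 1 \<Longrightarrow> W y z = 0" "W x y < 1 \<Longrightarrow> W y z < 1 \<Longrightarrow> W x z = 0"
proof -
  note b = graphonD(2,3)[OF W]
  have "0 \<le> (1 - W x y) * (1 - W x z) * W y z" "0 \<le> (1 - W x y) * (1 - W y z) * W x z"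
    using b xyz by auto
  then have "(1 - W x y) * (1 - W x z) * W y z = 0" "(1 - W x y) * (1 - W y z) * W x z = 0"
    using 0 unfolding cherry_def by linarith+
  then show "W x y < 1 \<Longrightarrow> W x z < 1 \<Longrightarrow> W y z = 0" "W x y < 1 \<Longrightarrow> W y z < 1 \<Longrightarrow> W x z = 0"
    by auto
qed

text \<open>The complement neighbourhood \<open>N x\<close> behaves like an equivalence class: the
  weight from \<open>x\<close> is almost everywhere 0 or 1, members are twins of \<open>x\<close>,
  and an outsider sharing a neighbour with \<open>x\<close> would create a cherry. Only the
  condition at the single root \<open>x\<close> enters.\<close>

lemma cherry_free_vertex:
  assumes W: "graphon W" and x: "x \<in> {0..1}" and pos: "0 < codegree W x"
    and free: "AE y in unit_interval. AE z in unit_interval. cherry W x y z = 0"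
  defines "N \<equiv> \<lambda>x. {y \<in> {0..1}. W x y < 1}"
  shows "measure unit_interval (N x) = codegree W x"
    and "AE y in unit_interval. y \<in> N x \<longrightarrow> codegree W y = codegree W x"
    and "AE w in unit_interval. w \<notin> N x \<longrightarrow> measure unit_interval (N w \<inter> N x) = 0"
proof -
  have [measurable]: "case_prod W \<in> borel_measurable (unit_interval \<Otimes>\<^sub>M unit_interval)"
    by (rule graphonD[OF W])
  have Wx[measurable]: "W y \<in> borel_measurable unit_interval" if "y \<in> {0..1}" for y
    by (rule graphon_section_measurable[OF W that])
  note [measurable] = Wx[OF x]
  have Nm: "N y \<in> sets unit_interval" if y: "y \<in> {0..1}" for y
  proof -
    have [measurable]: "W y \<in> borel_measurable unit_interval" using Wx[OF y] .
    have "N y = {z \<in> space unit_interval. W y z < 1}" by (simp add: N_def)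
    also have "\<dots> \<in> sets unit_interval" by measurable
    finally show ?thesis .
  qed
  note b = graphonD(2,3)[OF W]
  have sym: "W y z = W z y" if "y \<in> {0..1}" "z \<in> {0..1}" for y z
    using graphonD(4)[OF W that] .
  have swap: "AE z in unit_interval. AE y in unit_interval. cherry W x y z = 0"
  proof -
    have "{p \<in> space (unit_interval \<Otimes>\<^sub>M unit_interval). cherry W x (fst p) (snd p) = 0}
        \<in> sets (unit_interval \<Otimes>\<^sub>M unit_interval)"
      unfolding cherry_def by measurable
    from UI2.AE_commute[OF this] free show ?thesis by simp
  qed
  have nonnull: "\<not> (AE y in unit_interval. y \<notin> N x)"
  proof
    assume "AE y in unit_interval. y \<notin> N x"
    then have "AE y in unit_interval. 1 - W x y = 0" using AE_space
    proof eventually_elim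
      case (elim y)
      then show ?case using b(2)[OF x, of y] by (auto simp: N_def)
    qed
    then have "codegree W x = (\<integral>y. 0 \<partial>unit_interval)"
      unfolding codegree_def by (intro integral_cong_AE) auto
    then show False using pos by simp
  qed
  \<comment> \<open>For \<open>z\<close> in \<open>N x\<close> take another \<open>y\<close> in
    \<open>N x\<close>: the cherry centred at \<open>x\<close> yields \<open>W z y = 0\<close>, and
    then the one centred at \<open>y\<close> yields \<open>W x z = 0\<close>. Such a
    \<open>y\<close> exists because \<open>N x\<close> is not null.\<close>
  have zero: "AE z in unit_interval. z \<in> N x \<longrightarrow> W x z = 0"
    using free swap AE_space
  proof eventually_elim
    case (elim z)
    show ?case
    proof
      assume z: "z \<in> N x"
      have "AE y in unit_interval. y \<in> N x \<longrightarrow> W x z = 0"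
        using elim(1,2) AE_space
      proof eventually_elim
        case y: (elim y)
        show ?case
        proof
          assume yN: "y \<in> N x"
          have m: "y \<in> {0..1}" "z \<in> {0..1}" using yN z by (auto simp: N_def)
          have "W z y = 0"
            by (rule cherry_zeroD(1)[OF W x m(2,1) y(1)]) (use yN z in \<open>auto simp: N_def\<close>)
          then have "W y z < 1" using sym[OF m] by simp
          then show "W x z = 0"
            by (rule cherry_zeroD(2)[OF W x m y(2), rotated]) (use yN in \<open>auto simp: N_def\<close>)
        qed
      qed
      moreover have "AE y in unit_interval. y \<notin> N x"
        if "W x z \<noteq> 0" "AE y in unit_interval. y \<in> N x \<longrightarrow> W x z = 0"
        using that(2) by (rule eventually_mono) (use that(1) in simp)
      ultimately show "W x z = 0" using nonnull by blast
    qed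
  qed
  show "measure unit_interval (N x) = codegree W x"
  proof -
    have "codegree W x = (\<integral>y. indicator (N x) y \<partial>unit_interval)"
      unfolding codegree_def
    proof (rule integral_cong_AE)
      show "AE y in unit_interval. 1 - W x y = indicator (N x) y"
        using zero AE_space
      proof eventually_elim
        case (elim y)
        then show ?case using b(2)[OF x, of y] by (auto simp: N_def indicator_def)
      qed
    qed (use Nm[OF x] in auto)
    also have "\<dots> = measure unit_interval (N x \<inter> space unit_interval)"
      by (rule Bochner_Integration.integral_indicator)
    also have "N x \<inter> space unit_interval = N x" by (auto simp: N_def)
    finally show ?thesis by simp
  qed
  show "AE y in unit_interval. y \<in> N x \<longrightarrow> codegree W y = codegree W x"
    using free AE_space
  proof eventually_elim
    case (elim y)
    show ?case
    proof
      assume y: "y \<in> N x"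
      then have y1: "y \<in> {0..1}" by (simp add: N_def)
      note [measurable] = Wx[OF y1]
      show "codegree W y = codegree W x" unfolding codegree_def
      proof (rule integral_cong_AE)
        show "AE z in unit_interval. 1 - W y z = 1 - W x z"
          using elim(1) zero AE_space
        proof eventually_elim
          case z: (elim z)
          then have z1: "z \<in> {0..1}" by simp
          note ch = cherry_zeroD[OF W x y1 z1 z(1)]
          have yx: "W x y < 1" using y by (simp add: N_def)
          show ?case
          proof (cases "z \<in> N x")
            case True
            then show ?thesis using z(2) ch(1) yx by (auto simp: N_def)
          next
            case False
            then have "W x z = 1" using b(2)[OF x z1] z1 by (auto simp: N_def)
            moreover have "\<not> W y z < 1" using ch(2) yx calculation by auto
            ultimately show ?thesis using b(2)[OF y1 z1] by auto
          qed
        qed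
      qed auto
    qed
  qed
  show "AE w in unit_interval. w \<notin> N x \<longrightarrow> measure unit_interval (N w \<inter> N x) = 0"
    using swap AE_space
  proof eventually_elim
    case (elim w)
    show ?case
    proof
      assume w: "w \<notin> N x"
      have w1: "w \<in> {0..1}" using elim by simp
      have "W x w = 1" using w w1 b(2)[OF x w1] by (auto simp: N_def)
      \<comment> \<open>A common complement neighbour of \<open>w\<close> and \<open>x\<close> would
        force \<open>W x w = 0\<close>, against \<open>W x w = 1\<close>.\<close>
      have "AE y in unit_interval. y \<notin> N w \<inter> N x"
        using elim(1) AE_space
      proof eventually_elim
        case y: (elim y)
        then have y1: "y \<in> {0..1}" by simp
        show ?case
        proof
          assume "y \<in> N w \<inter> N x"
          then have "W x y < 1" "W y w < 1" using sym[OF y1 w1] by (auto simp: N_def)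
          then have "W x w = 0" by (rule cherry_zeroD(2)[OF W x y1 w1 y(1)])
          then show False using \<open>W x w = 1\<close> by simp
        qed
      qed
      then show "measure unit_interval (N w \<inter> N x) = 0"
        using Nm[OF x] Nm[OF w1] by (subst UI.prob_eq_0) auto
    qed
  qed
qed

text \<open>The parts are the complement neighbourhoods. As
  \<open>\<delta> \<noteq> \<beta>\<close>, the weight in \<open>cherry_density\<close> is nonzero
  on the class, so almost every point of it is a cherry-free root.\<close>

lemma codegree_class_measure:
  assumes W: "graphon W" and 0: "cherry_density \<beta> W = 0" and \<delta>: "0 < \<delta>" "\<delta> \<noteq> \<beta>"
  shows "\<exists>k::nat. measure unit_interval {x \<in> {0..1}. codegree W x = \<delta>} = real k * \<delta>"
proof (rule UI.measure_eq_multiple_of_parts[where N = "\<lambda>x. {y \<in> {0..1}. W x y < 1}"])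
  have [measurable]: "codegree W \<in> borel_measurable unit_interval"
    by (rule codegree_measurable[OF W])
  have "{x \<in> space unit_interval. codegree W x = \<delta>} \<in> sets unit_interval" by measurable
  then show "{x \<in> {0..1}. codegree W x = \<delta>} \<in> sets unit_interval" by simp
  show "{y \<in> {0..1}. W x y < 1} \<in> sets unit_interval" if "x \<in> space unit_interval" for x
  proof -
    have [measurable]: "W x \<in> borel_measurable unit_interval"
      using that by (intro graphon_section_measurable[OF W]) simp
    have "{y \<in> space unit_interval. W x y < 1} \<in> sets unit_interval" by measurable
    then show ?thesis by simp
  qed
  show "AE x in unit_interval. x \<in> {x \<in> {0..1}. codegree W x = \<delta>} \<longrightarrow>
      UI.prob {y \<in> {0..1}. W x y < 1} = \<delta> \<and>
      (AE y in unit_interval. y \<in> {y \<in> {0..1}. W x y < 1} \<longrightarrow> y \<in> {x \<in> {0..1}. codegree W x = \<delta>}) \<and>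
      (AE w in unit_interval. w \<notin> {y \<in> {0..1}. W x y < 1} \<longrightarrow>
        UI.prob ({y \<in> {0..1}. W w y < 1} \<inter> {y \<in> {0..1}. W x y < 1}) = 0)"
    using cherry_density_zeroD[OF W 0]
  proof eventually_elim
    case (elim x)
    show ?case
    proof
      assume "x \<in> {x \<in> {0..1}. codegree W x = \<delta>}"
      then have x: "x \<in> {0..1}" "codegree W x = \<delta>" by auto
      then have "AE y in unit_interval. AE z in unit_interval. cherry W x y z = 0"
        using elim \<delta> by simp
      note c = cherry_free_vertex[OF W x(1) _ this, unfolded x(2), OF \<delta>(1)]
      have "AE y in unit_interval. y \<in> {y \<in> {0..1}. W x y < 1} \<longrightarrow> y \<in> {x \<in> {0..1}. codegree W x = \<delta>}"
        using c(2) by eventually_elim auto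
      with c(1,3) show "UI.prob {y \<in> {0..1}. W x y < 1} = \<delta> \<and>
        (AE y in unit_interval. y \<in> {y \<in> {0..1}. W x y < 1} \<longrightarrow> y \<in> {x \<in> {0..1}. codegree W x = \<delta>}) \<and>
        (AE w in unit_interval. w \<notin> {y \<in> {0..1}. W x y < 1} \<longrightarrow>
        UI.prob ({y \<in> {0..1}. W w y < 1} \<inter> {y \<in> {0..1}. W x y < 1}) = 0)" by blast
    qed
  qed
qed (rule \<delta>(1))

section \<open>The constraint\<close>

text \<open>Vertices of degree \<open>7/16\<close> fill \<open>7/8\<close> of the space and contribute \<open>49/128\<close> to the mean degree. The
  remaining \<open>excess\<close> is \<open>2 d\<close> on measure \<open>s / 4\<close> plus \<open>d\<close> on measure \<open>1/8 - s / 4\<close>, that is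
  \<open>d\<close> times \<open>slope\<close>; multiplying through by \<open>slope\<close> keeps the conditions polynomial. Then
  \<open>degree_defect\<close> confines the degrees to \<open>7/16\<close>, \<open>d\<close>, \<open>2 d\<close>, and \<open>moment_defect\<close> fixes the measures
  of the three classes through the second moment.\<close>

definition P4_scale :: real where "P4_scale = (7/8) ^ 4 / 64"

definition moment :: "nat \<Rightarrow> (real \<Rightarrow> real \<Rightarrow> real) \<Rightarrow> real" where
  "moment k W = (\<integral>x. codegree W x ^ k \<partial>unit_interval)"

definition P4_param :: "(real \<Rightarrow> real \<Rightarrow> real) \<Rightarrow> real" where
  "P4_param W = ind_density P4 W / P4_scale"

definition slope :: "(real \<Rightarrow> real \<Rightarrow> real) \<Rightarrow> real" where
  "slope W = (1 + 2 * P4_param W) / 8"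

definition excess :: "(real \<Rightarrow> real \<Rightarrow> real) \<Rightarrow> real" where
  "excess W = moment 1 W - 49/128"

definition degree_defect :: "(real \<Rightarrow> real \<Rightarrow> real) \<Rightarrow> real" where
  "degree_defect W = (\<integral>x. ((codegree W x - 7/16) * (slope W * codegree W x - excess W)
     * (slope W * codegree W x - 2 * excess W))\<^sup>2 \<partial>unit_interval)"

definition moment_defect :: "(real \<Rightarrow> real \<Rightarrow> real) \<Rightarrow> real" where
  "moment_defect W = moment 2 W * (slope W)\<^sup>2 - (4 * (excess W)\<^sup>2 * (P4_param W / 4)
     + (excess W)\<^sup>2 * (1/8 - P4_param W / 4) + (slope W)\<^sup>2 * (7/8 * (7/16)\<^sup>2))"

text \<open>The first two terms are nonnegative on graphons, while \<open>moment_defect\<close> can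
  have either sign and is squared; one equation then expresses three conditions.\<close>

definition constraint :: "(real \<Rightarrow> real \<Rightarrow> real) \<Rightarrow> real" where
  "constraint W = cherry_density (7/16) W + degree_defect W + (moment_defect W)\<^sup>2"

lemma representable_P4_param: "representable P4_param"
  using representable_scale[OF representable_ind_density[of P4], of "1 / P4_scale"]
  by (simp add: P4_param_def[abs_def])

lemma representable_slope: "representable slope"
  using representable_scale[OF representable_add[OF representable_const[of 1]
    representable_scale[OF representable_P4_param, of 2]], of "1/8"]
  by (simp add: slope_def[abs_def])

lemma representable_excess: "representable excess"
  using representable_diff[OF representable_moment[of 1] representable_const[of "49/128"]]
  by (simp add: excess_def[abs_def] moment_def)

text \<open>These are the coefficients of the cubic inside \<open>degree_defect\<close> as a
  polynomial in the codegree, kept as functionals of \<open>W\<close> so that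
  \<open>representable_square_moment\<close> applies.\<close>

definition degree_coeff :: "nat \<Rightarrow> (real \<Rightarrow> real \<Rightarrow> real) \<Rightarrow> real" where
  "degree_coeff k = (if k = 0 then (\<lambda>W. (- 2 * (7/16)) * (excess W)\<^sup>2)
     else if k = 1 then (\<lambda>W. 2 * (excess W)\<^sup>2 + (3 * (7/16)) * (slope W * excess W))
     else if k = 2 then (\<lambda>W. (- 3) * (slope W * excess W) - (7/16) * (slope W)\<^sup>2)
     else (\<lambda>W. (slope W)\<^sup>2))"

lemma cubic_expand:
  fixes t \<beta> N Y :: real
  shows "(t - \<beta>) * (N * t - Y) * (N * t - 2 * Y) = (- 2 * \<beta>) * Y\<^sup>2 * t ^ 0
    + (2 * Y\<^sup>2 + (3 * \<beta>) * (N * Y)) * t ^ 1 + ((- 3) * (N * Y) - \<beta> * N\<^sup>2) * t ^ 2 + N\<^sup>2 * t ^ 3"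
  by (simp add: power2_eq_square power3_eq_cube algebra_simps)

lemma degree_coeff_sum:
  "(t - 7/16) * (slope W * t - excess W) * (slope W * t - 2 * excess W) = (\<Sum>k\<le>3. degree_coeff k W * t ^ k)"
proof -
  have "{..3} = {0, 1, 2, 3::nat}" by auto
  then show ?thesis unfolding cubic_expand by (simp add: degree_coeff_def)
qed

lemma representable_degree_defect: "representable degree_defect"
proof -
  have if_rep: "representable (if b then \<phi> else \<psi>)" if "representable \<phi>" "representable \<psi>" for b \<phi> \<psi>
    using that by simp
  have "representable (degree_coeff k)" for k
    unfolding degree_coeff_def
    by (intro if_rep representable_add representable_diff representable_scale representable_power
      representable_mult representable_slope representable_excess)
  then show ?thesis
    unfolding degree_defect_def[abs_def] degree_coeff_sum by (rule representable_square_moment)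
qed

lemma representable_constraint: "representable constraint"
proof -
  have "representable (\<lambda>W. moment 2 W * (slope W)\<^sup>2 - (P4_param W * (excess W)\<^sup>2
     + (excess W)\<^sup>2 * (1/8 - (1/4) * P4_param W) + (7/8 * (7/16)\<^sup>2) * (slope W)\<^sup>2))"
    unfolding moment_def
    by (intro representable_add representable_diff representable_scale representable_power representable_const
      representable_mult representable_slope representable_excess representable_P4_param representable_moment)
  then have "representable moment_defect"
    by (simp add: moment_defect_def[abs_def] mult_ac)
  then show ?thesis
    unfolding constraint_def[abs_def]
    by (intro representable_add representable_power representable_cherry_density representable_degree_defect)
qed

lemma degree_defect_integrable:
  assumes "graphon W"
  shows "integrable unit_interval (\<lambda>x. ((codegree W x - 7/16) * (slope W * codegree W x - excess W)
     * (slope W * codegree W x - 2 * excess W))\<^sup>2)"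
proof -
  have "(\<Sum>k\<le>3. degree_coeff k W * t ^ k)\<^sup>2
      = (\<Sum>i\<le>3. \<Sum>j\<le>3. degree_coeff i W * degree_coeff j W * t ^ (i + j))" for t
    by (simp add: power2_eq_square sum_product power_add mult_ac)
  then show ?thesis unfolding degree_coeff_sum
    by (auto intro!: Bochner_Integration.integrable_sum integrable_mult_right codegree_power_integrable assms)
qed

lemma constraint_eq_0_iff:
  assumes W: "graphon W"
  shows "constraint W = 0 \<longleftrightarrow> cherry_density (7/16) W = 0 \<and> degree_defect W = 0 \<and> moment_defect W = 0"
proof -
  have "0 \<le> degree_defect W" unfolding degree_defect_def by simp
  moreover note cherry_density_nonneg[OF W, of "7/16"]
  ultimately show ?thesis unfolding constraint_def
    by (auto simp: add_nonneg_eq_0_iff)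
qed

lemma moment_finite_range:
  assumes W: "graphon W" and D: "finite D" "AE x in unit_interval. codegree W x \<in> D"
  shows "moment k W = (\<Sum>\<delta>\<in>D. \<delta> ^ k * measure unit_interval {x \<in> {0..1}. codegree W x = \<delta>})"
proof -
  let ?A = "\<lambda>\<delta>. {x \<in> {0..1}. codegree W x = \<delta>}"
  have [measurable]: "codegree W \<in> borel_measurable unit_interval"
    by (rule codegree_measurable[OF W])
  have A: "?A \<delta> \<in> sets unit_interval" for \<delta>
  proof -
    have "{x \<in> space unit_interval. codegree W x = \<delta>} \<in> sets unit_interval" by measurable
    then show ?thesis by simp
  qed
  have int: "integrable unit_interval (indicator (?A \<delta>) :: real \<Rightarrow> real)" for \<delta>
    using A[of \<delta>] by (intro integrable_bounded_prob[where B = 1] prob_space_unit_interval) auto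
  have "moment k W = (\<integral>x. (\<Sum>\<delta>\<in>D. \<delta> ^ k * indicator (?A \<delta>) x) \<partial>unit_interval)"
    unfolding moment_def
  proof (rule integral_cong_AE)
    show "AE x in unit_interval. codegree W x ^ k = (\<Sum>\<delta>\<in>D. \<delta> ^ k * indicator (?A \<delta>) x)"
      using D(2) AE_space
    proof eventually_elim
      case (elim x)
      have "(\<Sum>\<delta>\<in>D. \<delta> ^ k * indicator (?A \<delta>) x) = (\<Sum>\<delta>\<in>D. if \<delta> = codegree W x then \<delta> ^ k else 0)"
        using elim by (intro sum.cong) (auto simp: indicator_def)
      then show ?case using elim D(1) by simp
    qed
  qed (use A in auto)
  also have "\<dots> = (\<Sum>\<delta>\<in>D. \<delta> ^ k * (\<integral>x. indicator (?A \<delta>) x \<partial>unit_interval))"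
    using int by simp
  also have "\<dots> = (\<Sum>\<delta>\<in>D. \<delta> ^ k * measure unit_interval (?A \<delta>))"
  proof -
    have "?A \<delta> \<inter> space unit_interval = ?A \<delta>" for \<delta> by auto
    then have "(\<integral>x. indicator (?A \<delta>) x \<partial>unit_interval) = measure unit_interval (?A \<delta>)" for \<delta>
      using Bochner_Integration.integral_indicator[of unit_interval "?A \<delta>"] by simp
    then show ?thesis by simp
  qed
  finally show ?thesis .
qed

lemma ind_density_K2_moment: "graphon W \<Longrightarrow> ind_density K2 W = 1 - moment 1 W"
  by (simp add: ind_density_K2 moment_def)

lemma multiple_in_gap:
  fixes k :: nat and r \<delta> :: real
  assumes "r = real k * \<delta>" "0 < r" "r < \<delta>"
  shows False
proof -
  have "0 < real k" "real k < 1"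
    using assms by (auto simp: zero_less_mult_iff mult_less_cancel_right1 mult_less_cancel_right2)
  then show False by simp
qed

text \<open>This supplies the lower bound: three moments determine the measures of the three
  classes, and tiling turns two of these measures into integrality conditions. The first alternative
  is the case \<open>d = 0\<close>.\<close>

lemma constraint_edge_density:
  assumes W: "graphon W" and 0: "constraint W = 0" and s: "0 < P4_param W" "P4_param W < 1/2"
  obtains "ind_density K2 W = 79/128"
  | n l :: nat where "0 < n" "P4_param W * real n = real l"
      "ind_density K2 W = 79/128 - (1 + 2 * P4_param W) / (64 * real n)"
proof -
  let ?\<beta> = "7/16 :: real"
  define N Y s d where "N = slope W" and "Y = excess W" and "s = P4_param W" and "d = Y / N"
  have N: "N = (1 + 2 * s) / 8" by (simp add: N_def s_def slope_def)
  have N0: "N > 0" using s by (simp add: N s_def)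
  have Y: "Y = d * N" using N0 by (simp add: d_def)
  have c: "cherry_density ?\<beta> W = 0" "degree_defect W = 0" "moment_defect W = 0"
    using constraint_eq_0_iff[OF W] 0 by auto
  have m1: "moment 1 W = 49/128 + d * N" using Y by (simp add: Y_def excess_def)
  have m2: "moment 2 W = 4 * d\<^sup>2 * (s / 4) + d\<^sup>2 * (1/8 - s/4) + 7/8 * ?\<beta>\<^sup>2"
  proof -
    have "moment 2 W * N\<^sup>2 = (4 * d\<^sup>2 * (s / 4) + d\<^sup>2 * (1/8 - s/4) + 7/8 * ?\<beta>\<^sup>2) * N\<^sup>2"
      using c(3) unfolding moment_defect_def N_def[symmetric] Y_def[symmetric] s_def[symmetric] Y
      by (simp add: algebra_simps power_mult_distrib)
    then show ?thesis using N0 by simp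
  qed
  have AE: "AE x in unit_interval. codegree W x \<in> {?\<beta>, d, 2 * d}"
  proof -
    have "AE x in unit_interval. ((codegree W x - ?\<beta>) * (N * codegree W x - Y) * (N * codegree W x - 2 * Y))\<^sup>2 = 0"
      using c(2) degree_defect_integrable[OF W] unfolding degree_defect_def N_def Y_def
      by (subst (asm) integral_nonneg_eq_0_iff_AE) auto
    then show ?thesis
    proof eventually_elim
      case (elim x)
      moreover have "N * codegree W x - Y = N * (codegree W x - d)"
        "N * codegree W x - 2 * Y = N * (codegree W x - 2 * d)"
        by (simp_all add: Y algebra_simps)
      ultimately show ?case using N0 by auto
    qed
  qed
  define \<mu> where "\<mu> \<delta> = measure unit_interval {x \<in> {0..1}. codegree W x = \<delta>}" for \<delta>
  have sum: "moment k W = (\<Sum>\<delta>\<in>{?\<beta>, d, 2 * d}. \<delta> ^ k * \<mu> \<delta>)" for k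
    unfolding \<mu>_def by (rule moment_finite_range[OF W _ AE]) simp
  have m0: "moment 0 W = 1" using UI.prob_space by (simp add: moment_def)
  have multiple: "\<exists>k::nat. \<mu> \<delta> = real k * \<delta>" if "0 < \<delta>" "\<delta> \<noteq> ?\<beta>" for \<delta>
    unfolding \<mu>_def by (rule codegree_class_measure[OF W c(1) that])
  have s': "0 < s" "s < 1/2" using s by (simp_all add: s_def)
  show thesis
  proof (cases "d = 0")
    case True
    then show ?thesis using m1 W that(1) by (simp add: ind_density_K2_moment)
  next
    case d0: False
    \<comment> \<open>Three moments determine the three measures only if the three values are
      distinct. In each coincidence two moments already give a class whose measure is positive but
      smaller than one clique.\<close>
    consider "d = ?\<beta>" | "2 * d = ?\<beta>" | "d \<noteq> ?\<beta>" "2 * d \<noteq> ?\<beta>" by blast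
    then show ?thesis
    proof cases
      case 1
      have "\<mu> ?\<beta> + \<mu> (7/8) = 1" "7/16 * \<mu> ?\<beta> + 7/8 * \<mu> (7/8) = 49/128 + 7/16 * N"
        using sum[of 0] sum[of 1] m0 m1 1 by auto
      then have "\<mu> (7/8) = s / 4" unfolding N by (simp add: field_simps)
      moreover obtain k :: nat where "\<mu> (7/8) = real k * (7/8)" using multiple[of "7/8"] by auto
      ultimately show ?thesis using multiple_in_gap[of "s/4" k "7/8"] s' by simp
    next
      case 2
      then have d: "d = 7/32" by simp
      have D: "{?\<beta>, d, 2 * d} = {7/16, 7/32}" by (auto simp: d)
      have "\<mu> ?\<beta> + \<mu> (7/32) = 1" "7/16 * \<mu> ?\<beta> + 7/32 * \<mu> (7/32) = 49/128 + 7/32 * N"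
        using sum[of 0, unfolded D] sum[of 1, unfolded D] m0 m1 d by auto
      then have "\<mu> (7/32) = 1/8 - s / 4" unfolding N by (simp add: field_simps)
      moreover obtain k :: nat where "\<mu> (7/32) = real k * (7/32)" using multiple[of "7/32"] by auto
      ultimately show ?thesis using multiple_in_gap[of "1/8 - s/4" k "7/32"] s' by simp
    next
      case 3
      define u v w where "u = \<mu> d" and "v = \<mu> (2 * d)" and "w = \<mu> ?\<beta>"
      have e0: "w + u + v = 1" and e1: "?\<beta> * w + d * u + 2 * d * v = 49/128 + d * N"
        and e2: "?\<beta>\<^sup>2 * w + d\<^sup>2 * u + 4 * d\<^sup>2 * v = 4 * d\<^sup>2 * (s / 4) + d\<^sup>2 * (1/8 - s/4) + 7/8 * ?\<beta>\<^sup>2"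
        using sum[of 0] sum[of 1] sum[of 2] m0 m1 m2 3 d0
        by (simp_all add: u_def v_def w_def power_mult_distrib)
      \<comment> \<open>Deviations from the intended measures satisfy a homogeneous Vandermonde
        system, with the distinct nodes 7/16, \<open>d\<close> and \<open>2 * d\<close>.\<close>
      define V X where "V = v - s / 4" and "X = w - 7/8"
      have v: "v = V + s / 4" and w: "w = X + 7/8" and u: "u = 1/8 - s/4 - V - X"
        using e0 by (simp_all add: V_def X_def)
      have 1: "d * V = - (?\<beta> - d) * X"
        using e1 unfolding v w u N by (simp add: algebra_simps add_divide_distrib)
      have 2: "3 * (d * (d * V)) + (?\<beta>\<^sup>2 - d\<^sup>2) * X = 0"
        using e2 unfolding v w u by (simp add: algebra_simps power2_eq_square add_divide_distrib)
      have "(?\<beta> - d) * (?\<beta> - 2 * d) * X = 0"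
        using 2 unfolding 1 by (simp add: algebra_simps power2_eq_square)
      then have "X = 0" using 3 by auto
      then have "V = 0" using 1 d0 by simp
      have u': "u = 1/8 - s/4" and v': "v = s/4" using \<open>X = 0\<close> \<open>V = 0\<close> u v by simp_all
      \<comment> \<open>So far \<open>d\<close> is a mere quotient and could be negative; being
        attained as a codegree excludes this.\<close>
      have "{x \<in> {0..1}. codegree W x = d} \<noteq> {}"
      proof
        assume e: "{x \<in> {0..1}. codegree W x = d} = {}"
        have "u = 0" unfolding u_def \<mu>_def e by simp
        then show False using u' s' by simp
      qed
      then obtain x where "x \<in> {0..1}" "codegree W x = d" by auto
      then have d: "d > 0" using codegree_bounds[OF W, of x] d0 by auto
      obtain k l :: nat where kl: "u = real k * d" "v = real l * (2 * d)"
        using multiple[of d] multiple[of "2 * d"] d 3 unfolding u_def v_def by auto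
      \<comment> \<open>A clique of measure \<open>2 * d\<close> counts twice, so \<open>n\<close>
        units of measure \<open>d\<close> fill exactly 1/8.\<close>
      define n where "n = k + 2 * l"
      have nd: "real n * d = 1/8" using kl u' v' by (simp add: n_def algebra_simps)
      then have n: "n > 0" by (cases n) auto
      have d': "d = 1 / (8 * real n)" using nd n by (simp add: field_simps)
      have "s * real n = real l"
        using kl(2) v' n unfolding d' by (simp add: field_simps)
      moreover have "ind_density K2 W = 79/128 - (1 + 2 * s) / (64 * real n)"
        unfolding ind_density_K2_moment[OF W] m1 N d' by simp
      ultimately show ?thesis using that(2)[OF n] by (simp add: s_def)
    qed
  qed
qed

section \<open>The extremal graphons\<close>

text \<open>The complement of the graphon consists of two blocks of density \<open>p\<close> on the halves of \<open>[0, 7/8)\<close>,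
  joined with density \<open>1 - p\<close>, and (if \<open>b\<close> holds) of cliques on the level sets of \<open>h\<close> in \<open>[7/8, 1]\<close>.\<close>

definition model :: "real \<Rightarrow> bool \<Rightarrow> (real \<Rightarrow> real) \<Rightarrow> real \<Rightarrow> real \<Rightarrow> real" where
  "model p b h x y = 1 - (if x < 7/8 \<and> y < 7/8 then (if (x < 7/16) = (y < 7/16) then p else 1 - p)
     else if b \<and> 7/8 \<le> x \<and> 7/8 \<le> y \<and> h x = h y then 1 else 0)"

lemma measurable_unit_interval:
  "f \<in> borel_measurable borel \<Longrightarrow> f \<in> borel_measurable unit_interval"
  by (simp add: unit_interval_def measurable_restrict_space1)

lemma measure_unit_interval:
  assumes "A \<in> sets borel" "A \<subseteq> {0..1}"
  shows "A \<in> sets unit_interval" "measure unit_interval A = measure lborel A"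
  using assms by (auto simp: unit_interval_def sets_restrict_space measure_restrict_space)

lemma measure_unit_interval_Ico:
  assumes "0 \<le> l" "l \<le> u" "u \<le> 1"
  shows "{l..<u} \<in> sets unit_interval" "measure unit_interval {l..<u} = u - l"
proof -
  have "{l..<u} \<subseteq> {0..1}" using assms by auto
  then show "{l..<u} \<in> sets unit_interval" "measure unit_interval {l..<u} = u - l"
    using measure_unit_interval[of "{l..<u}"] assms by auto
qed

lemma measure_unit_interval_Icc:
  assumes "0 \<le> l" "l \<le> u" "u \<le> 1"
  shows "{l..u} \<in> sets unit_interval" "measure unit_interval {l..u} = u - l"
proof -
  have "{l..u} \<subseteq> {0..1}" using assms by auto
  then show "{l..u} \<in> sets unit_interval" "measure unit_interval {l..u} = u - l"
    using measure_unit_interval[of "{l..u}"] assms by auto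
qed

lemma integrable_indicator_unit_interval:
  "A \<in> sets unit_interval \<Longrightarrow> integrable unit_interval (indicator A :: real \<Rightarrow> real)"
  by (intro integrable_bounded_prob[where B = 1] prob_space_unit_interval) auto

lemma integral_indicator_unit_interval:
  assumes "A \<in> sets unit_interval"
  shows "(\<integral>x. indicator A x \<partial>unit_interval) = measure unit_interval A"
proof -
  have "A \<inter> space unit_interval = A" using sets.sets_into_space[OF assms] by auto
  then show ?thesis using Bochner_Integration.integral_indicator[of unit_interval A] by simp
qed

lemma AE_unit_interval_less_1: "AE x in unit_interval. x < 1"
proof -
  have "measure unit_interval {1} = 0" "{1} \<in> sets unit_interval"
    using measure_unit_interval[of "{1}"] by auto
  then have "AE x in unit_interval. x \<notin> {1}"
    by (subst UI.prob_eq_0[symmetric]) auto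
  then show ?thesis using AE_space by eventually_elim auto
qed

context
  fixes p :: real and b :: bool and h :: "real \<Rightarrow> real"
  assumes p: "0 \<le> p" "p \<le> 1" and h: "h \<in> borel_measurable borel"
begin

lemma graphon_model: "graphon (model p b h)"
proof -
  let ?M = "unit_interval \<Otimes>\<^sub>M unit_interval"
  have [measurable]: "(\<lambda>z. fst z) \<in> borel_measurable ?M" "(\<lambda>z. snd z) \<in> borel_measurable ?M"
    "(\<lambda>z. h (fst z)) \<in> borel_measurable ?M" "(\<lambda>z. h (snd z)) \<in> borel_measurable ?M"
    by (rule measurable_compose[OF measurable_fst] measurable_compose[OF measurable_snd],
        rule measurable_unit_interval, simp add: h)+
  have "case_prod (model p b h) \<in> borel_measurable ?M"
    unfolding model_def case_prod_unfold by measurable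
  then show ?thesis
    unfolding graphon_def using p by (auto simp: model_def)
qed

text \<open>The halves have equal measure, so the weights \<open>p\<close> and \<open>1 - p\<close>
  always average to 1/2 over the block of measure 7/8.\<close>

lemma codegree_model_low:
  assumes "0 \<le> x" "x < 7/8"
  shows "codegree (model p b h) x = 7/16"
proof -
  have m: "{0..<7/16} \<in> sets unit_interval" "measure unit_interval {0..<7/16} = 7/16"
    "{7/16..<7/8} \<in> sets unit_interval" "measure unit_interval {7/16..<7/8} = 7/16"
    using measure_unit_interval_Ico[of 0 "7/16"] measure_unit_interval_Ico[of "7/16" "7/8"] by auto
  define q r where "q = (if x < 7/16 then p else 1 - p)" and "r = (if x < 7/16 then 1 - p else p)"
  have "codegree (model p b h) x
      = (\<integral>y. q * indicator {0..<7/16} y + r * indicator {7/16..<7/8} y \<partial>unit_interval)"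
    unfolding codegree_def
    by (rule Bochner_Integration.integral_cong)
       (use assms in \<open>auto simp: model_def q_def r_def indicator_def\<close>)
  also have "\<dots> = q * (7/16) + r * (7/16)"
    using m(1,3) by (simp add: m(2,4) integrable_indicator_unit_interval integral_indicator_unit_interval
      del: Bochner_Integration.integral_indicator)
  also have "\<dots> = 7/16" by (simp add: q_def r_def field_simps)
  finally show ?thesis .
qed

lemma codegree_model_high:
  assumes "7/8 \<le> x"
  shows "codegree (model p b h) x = (if b then measure unit_interval {y \<in> {7/8..1}. h x = h y} else 0)"
proof -
  have [measurable]: "(\<lambda>y. y) \<in> borel_measurable unit_interval" "h \<in> borel_measurable unit_interval"
    using h by (auto intro: measurable_unit_interval)
  have "{y \<in> {7/8..1}. h x = h y} = {y \<in> space unit_interval. 7/8 \<le> y \<and> h x = h y}" by auto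
  also have "\<dots> \<in> sets unit_interval" by measurable
  finally have m: "{y \<in> {7/8..1}. h x = h y} \<in> sets unit_interval" .
  have "codegree (model p b h) x
      = (\<integral>y. (if b then 1 else 0) * indicator {y \<in> {7/8..1}. h x = h y} y \<partial>unit_interval)"
    unfolding codegree_def
    by (rule Bochner_Integration.integral_cong) (use assms in \<open>auto simp: model_def indicator_def\<close>)
  also have "\<dots> = (if b then measure unit_interval {y \<in> {7/8..1}. h x = h y} else 0)"
    using m by (simp add: integral_indicator_unit_interval
      del: Bochner_Integration.integral_indicator)
  finally show ?thesis .
qed

text \<open>The weight vanishes at roots below 7/8; from 7/8 on, the complement is empty or an
  equivalence relation, and neither contains a cherry.\<close>

lemma cherry_density_model: "cherry_density (7/16) (model p b h) = 0"
proof -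
  have "(codegree (model p b h) (x 0) - 7/16)\<^sup>2 * cherry (model p b h) (x 0) (x 1) (x 2) = 0"
    if "x \<in> space (\<Pi>\<^sub>M u\<in>{0, 1, 2::nat}. unit_interval)" for x
  proof (cases "x 0 < 7/8")
    case True
    have "0 \<le> x 0" using that by (auto simp: space_PiM PiE_iff)
    then show ?thesis using True by (simp add: codegree_model_low)
  next
    case False
    then have "cherry (model p b h) (x 0) (x 1) (x 2) = 0"
      unfolding cherry_def model_def by auto
    then show ?thesis by simp
  qed
  then have "cherry_density (7/16) (model p b h) = (\<integral>x. 0 \<partial>(\<Pi>\<^sub>M u\<in>{0, 1, 2::nat}. unit_interval))"
    unfolding cherry_density_def by (rule Bochner_Integration.integral_cong[OF refl])
  then show ?thesis by simp
qed

end

section \<open>The density of \<open>P4\<close> in the model as a function of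
  \<open>p\<close>\<close>

lemma ind_density_P4:
  "ind_density P4 W = monomial_density {0, 1, 2, 3} {(0, 1), (1, 2), (2, 3)} {(0, 2), (0, 3), (1, 3)} W"
proof -
  have v: "verts P4 = {0, 1, 2, 3}" "edges P4 = {{0, 1}, {1, 2}, {2, 3}}" by (transfer, simp)+
  have vp: "vpairs {0, 1, 2, 3} = {(0, 1), (0, 2), (0, 3), (1, 2), (1, 3), (2, 3)}"
    by (auto simp: vpairs_def)
  have "edge_pairs P4 = {(u, v). (u, v) \<in> vpairs {0, 1, 2, 3} \<and> {u, v} \<in> edges P4}"
    unfolding edge_pairs_def vpairs_def v(1) by auto
  also have "\<dots> = {(0, 1), (1, 2), (2, 3)}"
    by (auto simp: v(2) vp[simplified] doubleton_eq_iff)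
  finally have e: "edge_pairs P4 = {(0, 1), (1, 2), (2, 3)}" .
  have "vpairs (verts P4) - edge_pairs P4 = {(0, 2), (0, 3), (1, 3)}"
    unfolding v(1) e vp by auto
  then show ?thesis by (simp add: ind_density_eq v(1) e)
qed

abbreviation P4_monomial :: "(real \<Rightarrow> real \<Rightarrow> real) \<Rightarrow> (nat \<Rightarrow> real) \<Rightarrow> real" where
  "P4_monomial \<equiv> monomial {(0, 1), (1, 2), (2, 3)} {(0, 2), (0, 3), (1, 3)}"

lemma P4_monomial_eq:
  "P4_monomial W x = W (x 0) (x 1) * W (x 1) (x 2) * W (x 2) (x 3)
    * ((1 - W (x 0) (x 2)) * (1 - W (x 0) (x 3)) * (1 - W (x 1) (x 3)))"
  by (simp add: monomial_def mult_ac)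

text \<open>The complement of a path on four vertices is connected, so an induced path lies inside one
  component of the complement.\<close>

lemma P4_monomial_model:
  "P4_monomial (model p b h) x = P4_monomial (model p False (\<lambda>_. 0)) x"
  unfolding P4_monomial_eq model_def by auto

definition P4_value :: "real \<Rightarrow> real" where
  "P4_value p = ind_density P4 (model p False (\<lambda>_. 0))"

lemma ind_density_P4_model: "ind_density P4 (model p b h) = P4_value p"
  unfolding P4_value_def ind_density_P4 monomial_density_def
  by (rule Bochner_Integration.integral_cong[OF refl P4_monomial_model])

text \<open>At \<open>p = 1\<close> the complement is a disjoint union of two cliques and isolated
  vertices, so the graphon is complete multipartite and has no induced path on four
  vertices.\<close>

lemma P4_value_1: "P4_value 1 = 0"
proof -
  have "P4_monomial (model 1 False (\<lambda>_. 0)) x = 0" for x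
    unfolding P4_monomial_eq model_def by auto
  then have "P4_monomial (model 1 False (\<lambda>_. 0)) = (\<lambda>x. 0)" by (rule ext)
  then show ?thesis unfolding P4_value_def ind_density_P4 monomial_density_def by simp
qed

text \<open>At \<open>p = 1/2\<close> each of the six pairs inside the block contributes 1/2,
  whether edge or non-edge, and all four vertices must lie in the block. This is the origin of
  \<open>P4_scale\<close>.\<close>

lemma P4_value_half: "P4_value (1/2) = P4_scale"
proof -
  have "P4_monomial (model (1/2) False (\<lambda>_. 0)) x = (\<Prod>i\<in>{0, 1, 2, 3::nat}. indicator {0..<7/8} (x i)) / 64"
    if "x \<in> space (\<Pi>\<^sub>M u\<in>{0, 1, 2, 3::nat}. unit_interval)" for x
    using that unfolding P4_monomial_eq model_def by (auto simp: space_PiM PiE_iff indicator_def)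
  then have "P4_value (1/2) =
      (\<integral>x. (\<Prod>i\<in>{0, 1, 2, 3::nat}. indicator {0..<7/8} (x i)) / 64 \<partial>(\<Pi>\<^sub>M u\<in>{0, 1, 2, 3::nat}. unit_interval))"
    unfolding P4_value_def ind_density_P4 monomial_density_def
    by (intro Bochner_Integration.integral_cong[OF refl])
  also have "\<dots> = (\<integral>x. (\<Prod>i\<in>{0, 1, 2, 3::nat}. indicator {0..<7/8} (x i)) \<partial>(\<Pi>\<^sub>M u\<in>{0, 1, 2, 3::nat}. unit_interval)) / 64"
    by (rule integral_divide_zero)
  also have "(\<integral>x. (\<Prod>i\<in>{0, 1, 2, 3::nat}. indicator {0..<7/8} (x i) :: real) \<partial>(\<Pi>\<^sub>M u\<in>{0, 1, 2, 3::nat}. unit_interval))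
      = (\<Prod>i\<in>{0, 1, 2, 3::nat}. \<integral>t. indicator {0..<7/8::real} t \<partial>unit_interval)"
    by (rule UIP.product_integral_prod[where f = "\<lambda>_. indicator {0..<7/8}"])
       (auto intro!: integrable_indicator_unit_interval measure_unit_interval_Ico)
  also have "\<dots> = (7/8 :: real) ^ 4"
    using measure_unit_interval_Ico(1)[of 0 "7/8"] measure_unit_interval_Ico(2)[of 0 "7/8"]
    unfolding integral_indicator_unit_interval[OF measure_unit_interval_Ico(1)[of 0 "7/8", simplified]]
    by (simp only: prod_constant) (simp add: power_divide)
  finally show ?thesis by (simp add: P4_scale_def)
qed

lemma P4_value_continuous: "continuous_on {0..1} P4_value"
proof (subst continuous_on_sequentially, intro allI ballI impI, elim conjE)
  fix q :: "nat \<Rightarrow> real" and p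
  assume p: "p \<in> {0..1}" and q: "\<forall>n. q n \<in> {0..1}" and lim: "q \<longlonglongrightarrow> p"
  let ?M = "\<Pi>\<^sub>M u\<in>{0, 1, 2, 3::nat}. unit_interval"
  let ?f = "\<lambda>p. P4_monomial (model p False (\<lambda>_. 0))"
  have sub: "{(0, 1), (1, 2), (2, 3)} \<subseteq> vpairs {0, 1, 2, 3}" "{(0, 2), (0, 3), (1, 3)} \<subseteq> vpairs {0, 1, 2, 3}"
    by (auto simp: vpairs_def)
  have gr: "graphon (model r False (\<lambda>_. 0))" if "r \<in> {0..1}" for r
    using that by (intro graphon_model) auto
  have "(\<lambda>n. integral\<^sup>L ?M (?f (q n))) \<longlonglongrightarrow> integral\<^sup>L ?M (?f p)"
  proof (rule integral_dominated_convergence[where w = "\<lambda>_. 1"])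
    show "?f p \<in> borel_measurable ?M" by (rule monomial_measurable[OF gr[OF p] sub])
    show "?f (q n) \<in> borel_measurable ?M" for n using q by (intro monomial_measurable[OF gr sub]) auto
    show "integrable ?M (\<lambda>_. 1 :: real)"
      by (rule integrable_bounded_prob[OF prob_space_cube]) auto
    show "AE x in ?M. (\<lambda>n. ?f (q n) x) \<longlonglongrightarrow> ?f p x"
    proof (rule AE_I2)
      fix x
      have "(\<lambda>n. model (q n) False (\<lambda>_. 0) u v) \<longlonglongrightarrow> model p False (\<lambda>_. 0) u v" for u v
        unfolding model_def by (auto intro!: tendsto_intros lim)
      then show "(\<lambda>n. ?f (q n) x) \<longlonglongrightarrow> ?f p x"
        unfolding P4_monomial_eq by (intro tendsto_intros)
    qed
    show "AE x in ?M. norm (?f (q n) x) \<le> 1" for n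
    proof (rule AE_I2)
      fix x assume "x \<in> space ?M"
      then have "x \<in> {0, 1, 2, 3} \<rightarrow> {0..1}" by (auto simp: space_PiM PiE_iff)
      then show "norm (?f (q n) x) \<le> 1"
        using monomial_bounds[OF gr sub, of "q n" x] q by auto
    qed
  qed
  then show "(P4_value \<circ> q) \<longlonglongrightarrow> P4_value p"
    by (simp add: P4_value_def ind_density_P4 monomial_density_def comp_def)
qed

lemma P4_scale_pos: "0 < P4_scale"
  by (simp add: P4_scale_def)

text \<open>The intermediate value theorem on \<open>{1/2..1}\<close>, between the values
  \<open>P4_scale\<close> and 0.\<close>

lemma ex_P4_value:
  assumes "0 \<le> s" "s \<le> 1"
  obtains p where "0 \<le> p" "p \<le> 1" "P4_value p = P4_scale * s"
proof -
  have "\<exists>p\<ge>1/2. p \<le> 1 \<and> P4_value p = P4_scale * s"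
  proof (rule IVT2')
    show "continuous_on {1/2..1} P4_value"
      by (rule continuous_on_subset[OF P4_value_continuous]) auto
  qed (use P4_scale_pos assms in \<open>auto simp: P4_value_1 P4_value_half\<close>)
  then obtain p where "1/2 \<le> p" "p \<le> 1" "P4_value p = P4_scale * s" by blast
  then show ?thesis by (intro that[of p]) auto
qed

section \<open>Edge densities attained by the model\<close>

lemma moment_step:
  assumes W: "graphon W" and a: "0 \<le> a" "a \<le> 1/8"
    and step: "AE x in unit_interval. codegree W x = (if x < 7/8 then 7/16 else if x < 7/8 + a then 2 * d else d)"
  shows "moment k W = 7/8 * (7/16) ^ k + a * (2 * d) ^ k + (1/8 - a) * d ^ k"
proof -
  let ?A = "{0..<7/8::real}" and ?B = "{7/8..<7/8 + a}" and ?C = "{7/8 + a..1}"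
  have m: "?A \<in> sets unit_interval" "measure unit_interval ?A = 7/8"
    "?B \<in> sets unit_interval" "measure unit_interval ?B = a"
    "?C \<in> sets unit_interval" "measure unit_interval ?C = 1/8 - a"
    using measure_unit_interval_Ico[of 0 "7/8"] measure_unit_interval_Ico[of "7/8" "7/8 + a"]
      measure_unit_interval_Icc[of "7/8 + a" 1] a by auto
  have [measurable]: "codegree W \<in> borel_measurable unit_interval"
    by (rule codegree_measurable[OF W])
  have "moment k W = (\<integral>x. (7/16) ^ k * indicator ?A x + (2 * d) ^ k * indicator ?B x + d ^ k * indicator ?C x \<partial>unit_interval)"
    unfolding moment_def
  proof (rule integral_cong_AE)
    show "AE x in unit_interval. codegree W x ^ k
        = (7/16) ^ k * indicator ?A x + (2 * d) ^ k * indicator ?B x + d ^ k * indicator ?C x"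
      using step AE_space by eventually_elim (use a in \<open>auto simp: indicator_def\<close>)
  qed (use m in auto)
  also have "\<dots> = (7/16) ^ k * (7/8) + (2 * d) ^ k * a + d ^ k * (1/8 - a)"
    using m by (simp add: integrable_indicator_unit_interval integral_indicator_unit_interval
      del: Bochner_Integration.integral_indicator)
  finally show ?thesis by (simp add: mult_ac)
qed

text \<open>Only the codegree profile and the cherry condition enter, so one computation serves the
  model with cliques and, with \<open>d = 0\<close>, the model without them.\<close>

lemma constraint_step:
  assumes W: "graphon W" and s: "P4_param W = s" "0 \<le> s" "s \<le> 1/2"
    and ch: "cherry_density (7/16) W = 0"
    and step: "AE x in unit_interval. codegree W x = (if x < 7/8 then 7/16 else if x < 7/8 + s/4 then 2 * d else d)"
  shows "constraint W = 0" "ind_density K2 W = 79/128 - d * (1 + 2 * s) / 8"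
proof -
  have m: "moment k W = 7/8 * (7/16) ^ k + s/4 * (2 * d) ^ k + (1/8 - s/4) * d ^ k" for k
    using s by (intro moment_step[OF W _ _ step]) auto
  have N: "slope W = (1 + 2 * s) / 8" by (simp add: slope_def s)
  have m1: "moment 1 W = 49/128 + d * (1 + 2 * s) / 8"
    unfolding m by (simp add: field_simps)
  have Y: "excess W = d * slope W" unfolding excess_def m1 N by simp
  have "degree_defect W = (\<integral>x. 0 \<partial>unit_interval)"
    unfolding degree_defect_def
  proof (rule integral_cong_AE)
    show "AE x in unit_interval. ((codegree W x - 7/16) * (slope W * codegree W x - excess W)
     * (slope W * codegree W x - 2 * excess W))\<^sup>2 = 0"
      using step by eventually_elim (auto simp: Y)
  qed (use degree_defect_integrable[OF W] in auto)
  moreover have "moment_defect W = 0"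
    unfolding moment_defect_def s Y m by (simp add: algebra_simps power_mult_distrib)
  ultimately show "constraint W = 0"
    by (simp add: constraint_def ch)
  show "ind_density K2 W = 79/128 - d * (1 + 2 * s) / 8"
    unfolding ind_density_K2_moment[OF W] m1 by simp
qed

text \<open>Leaving out the cliques removes every arithmetic condition on \<open>s\<close>; this
  makes irrational values feasible.\<close>

lemma ex_model_generic:
  assumes s: "0 \<le> s" "s \<le> 1/2"
  obtains W where "graphon W" "constraint W = 0" "ind_density P4 W = P4_scale * s"
    "ind_density K2 W = 79/128"
proof -
  obtain p where p: "0 \<le> p" "p \<le> 1" "P4_value p = P4_scale * s"
    using ex_P4_value[of s] s by auto
  let ?W = "model p False (\<lambda>_. 0)"
  have W: "graphon ?W" using p by (intro graphon_model) auto
  have P4: "ind_density P4 ?W = P4_scale * s" by (simp add: ind_density_P4_model p)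
  have "AE x in unit_interval. codegree ?W x = (if x < 7/8 then 7/16 else if x < 7/8 + s/4 then 2 * 0 else 0)"
    using p by (intro AE_I2) (auto simp: codegree_model_low codegree_model_high)
  from constraint_step[OF W _ s cherry_density_model this] show ?thesis
    using that[OF W _ P4] p P4 P4_scale_pos by (simp add: P4_param_def)
qed

text \<open>Subdivide \<open>[7/8, 1]\<close> into \<open>n\<close> cells of length \<open>1 / (8 n)\<close>; the first \<open>2 l\<close> of them are merged in
  pairs.\<close>

definition cell :: "nat \<Rightarrow> nat \<Rightarrow> real \<Rightarrow> int" where
  "cell n l x = (let j = \<lfloor>(8 * x - 7) * real n\<rfloor> in if j < 2 * int l then 2 * (j div 2) else j)"

lemma cell_measurable: "(\<lambda>x. real_of_int (cell n l x)) \<in> borel_measurable borel"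
proof -
  have "(\<lambda>x. \<lfloor>(8 * x - 7) * real n\<rfloor>) \<in> measurable borel (count_space UNIV)"
    by measurable
  then have "(\<lambda>x. (\<lambda>j. real_of_int (if j < 2 * int l then 2 * (j div 2) else j)) \<lfloor>(8 * x - 7) * real n\<rfloor>)
      \<in> borel_measurable borel"
    by (rule measurable_compose) simp
  then show ?thesis by (simp add: cell_def Let_def)
qed

lemma floor_cell_iff:
  assumes "0 < n"
  shows "i \<le> \<lfloor>(8 * y - 7) * real n\<rfloor> \<longleftrightarrow> 7/8 + real_of_int i / (8 * real n) \<le> y"
    and "\<lfloor>(8 * y - 7) * real n\<rfloor> < i \<longleftrightarrow> y < 7/8 + real_of_int i / (8 * real n)"
  using assms by (auto simp: le_floor_iff floor_less_iff field_simps)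

text \<open>At \<open>x = 1\<close> the floor equals \<open>n\<close>, which gives a cell consisting
  of one point; the strict bound excludes just this null set.\<close>

lemma measure_cell:
  assumes n: "0 < n" "2 * l \<le> n" and x: "7/8 \<le> x" "x < 1"
  shows "measure unit_interval {y \<in> {7/8..1}. cell n l x = cell n l y}
    = (if x < 7/8 + 2 * real l / (8 * real n) then 2 / (8 * real n) else 1 / (8 * real n))"
proof -
  define J where "J y = \<lfloor>(8 * y - 7) * real n\<rfloor>" for y
  note J = floor_cell_iff[OF n(1), folded J_def]
  have Jx: "0 \<le> J x" "J x < int n"
    unfolding J using x n by auto
  have interval: "measure unit_interval {y \<in> {7/8..1}. i \<le> J y \<and> J y < i'} = real_of_int (i' - i) / (8 * real n)"
    if i: "0 \<le> i" "i \<le> i'" "i' \<le> int n" for i i'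
  proof -
    let ?l = "7/8 + real_of_int i / (8 * real n)" and ?u = "7/8 + real_of_int i' / (8 * real n)"
    have lu: "7/8 \<le> ?l" "?l \<le> ?u" "?u \<le> 1"
      using i n by (auto simp: divide_simps)
    have "{y \<in> {7/8..1}. i \<le> J y \<and> J y < i'} = {?l..<?u}"
      unfolding J using lu by auto
    moreover have "?u - ?l = real_of_int (i' - i) / (8 * real n)"
      by (simp add: diff_divide_distrib)
    ultimately show ?thesis
      using measure_unit_interval_Ico(2)[of ?l ?u] lu by simp
  qed
  have c: "cell n l y = (if J y < 2 * int l then 2 * (J y div 2) else J y)" for y
    by (simp add: cell_def J_def Let_def)
  show ?thesis
  proof (cases "J x < 2 * int l")
    case True
    \<comment> \<open>The merged pair consists of the cells \<open>i\<close> and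
      \<open>i + 1\<close>; as \<open>2 * l\<close> is even, both lie in the merged range.\<close>
    define i where "i = 2 * (J x div 2)"
    have "J x div 2 < int l" using True by presburger
    then have i: "0 \<le> i" "i + 2 \<le> 2 * int l" "i + 2 \<le> int n" "even i" using True Jx n by (auto simp: i_def)
    have "cell n l x = cell n l y \<longleftrightarrow> i \<le> J y \<and> J y < i + 2" for y
      unfolding c using True i by (auto simp: i_def)
    then have "measure unit_interval {y \<in> {7/8..1}. cell n l x = cell n l y} = 2 / (8 * real n)"
      using interval[of i "i + 2"] i by simp
    then show ?thesis using True J(2)[of x "2 * int l"] by simp
  next
    case False
    have "cell n l x = cell n l y \<longleftrightarrow> J x \<le> J y \<and> J y < J x + 1" for y
      unfolding c using False by auto
    then have "measure unit_interval {y \<in> {7/8..1}. cell n l x = cell n l y} = 1 / (8 * real n)"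
      using interval[of "J x" "J x + 1"] Jx by simp
    then show ?thesis using False J(2)[of x "2 * int l"] by simp
  qed
qed

lemma ex_model_rational:
  assumes s: "0 \<le> s" "s \<le> 1/2" and n: "0 < n" and l: "s * real n = real l"
  obtains W where "graphon W" "constraint W = 0" "ind_density P4 W = P4_scale * s"
    "ind_density K2 W = 79/128 - (1 + 2 * s) / (64 * real n)"
proof -
  obtain p where p: "0 \<le> p" "p \<le> 1" "P4_value p = P4_scale * s"
    using ex_P4_value[of s] s by auto
  let ?h = "\<lambda>x. real_of_int (cell n l x)"
  let ?W = "model p True ?h"
  have W: "graphon ?W" using p by (intro graphon_model cell_measurable) auto
  have P4: "ind_density P4 ?W = P4_scale * s" by (simp add: ind_density_P4_model p)
  have sl: "s = real l / real n" using l n by (simp add: field_simps)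
  \<comment> \<open>The bound on \<open>s\<close> leaves room for \<open>l\<close> pairs among the
    \<open>n\<close> cells.\<close>
  have "real l \<le> 1/2 * real n" using s(2) n unfolding l[symmetric] by (intro mult_right_mono) auto
  then have ln: "2 * l \<le> n" by linarith
  have "AE x in unit_interval. codegree ?W x =
      (if x < 7/8 then 7/16 else if x < 7/8 + s/4 then 2 * (1 / (8 * real n)) else 1 / (8 * real n))"
    using AE_unit_interval_less_1 AE_space
  proof eventually_elim
    case (elim x)
    \<comment> \<open>The merged range consists of \<open>2 * l\<close> cells, so it has the length
      that \<open>constraint_step\<close> expects.\<close>
    have "2 * real l / (8 * real n) = s / 4" by (simp add: sl)
    then show ?case
      using elim p measure_cell[OF n ln, of x] cell_measurable[of n l]
      by (auto simp: codegree_model_low codegree_model_high)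
  qed
  from constraint_step[OF W _ s cherry_density_model this] show ?thesis
    using that[OF W _ P4] p P4 P4_scale_pos cell_measurable[of n l] by (simp add: P4_param_def)
qed

section \<open>Nowhere differentiability\<close>

text \<open>Fractions need not be in lowest terms: for rational \<open>s \<ge> 0\<close> these are
  all positive multiples of the reduced denominator, just as for the number of cells in the
  model.\<close>

definition denominators :: "real \<Rightarrow> nat set" where
  "denominators s = {n. 0 < n \<and> (\<exists>l::nat. s * real n = real l)}"

text \<open>The least denominator is the reduced one, so on nonnegative reals this is Thomae's
  function.\<close>

definition thomae :: "real \<Rightarrow> real" where
  "thomae s = (if denominators s = {} then 0 else 1 / real (LEAST n. n \<in> denominators s))"

lemma thomae_ge:
  assumes "n \<in> denominators s"
  shows "1 / real n \<le> thomae s"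
proof -
  let ?m = "LEAST n. n \<in> denominators s"
  have "?m \<in> denominators s" "?m \<le> n" using assms by (auto intro: LeastI Least_le)
  then show ?thesis using assms by (auto simp: thomae_def denominators_def intro!: divide_left_mono)
qed

lemma thomae_cases:
  obtains "denominators s = {}" "thomae s = 0"
  | n where "n \<in> denominators s" "thomae s = 1 / real n"
proof (cases "denominators s = {}")
  case True
  then show ?thesis using that(1) by (simp add: thomae_def)
next
  case False
  then have "(LEAST n. n \<in> denominators s) \<in> denominators s" by (auto intro: LeastI)
  then show ?thesis using that(2) False by (simp add: thomae_def)
qed

lemma denominators_irrational: "s \<notin> \<rat> \<Longrightarrow> denominators s = {}"
proof (rule ccontr)
  assume s: "s \<notin> \<rat>" "denominators s \<noteq> {}"
  then obtain n l :: nat where "0 < n" "s * real n = real l" by (auto simp: denominators_def)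
  then have "s = real l / real n" by (simp add: field_simps)
  then show False using s(1) by simp
qed

lemma denominators_rational: "s \<in> \<rat> \<Longrightarrow> 0 \<le> s \<Longrightarrow> denominators s \<noteq> {}"
proof -
  assume s: "s \<in> \<rat>" "0 \<le> s"
  then obtain m n :: nat where "n \<noteq> 0" "\<bar>s\<bar> = real m / real n" using Rats_abs_nat_div_natE by metis
  then have "n \<in> denominators s" using s(2) by (auto simp: denominators_def field_simps)
  then show ?thesis by blast
qed

lemma exists_irrational_between:
  fixes a b :: real
  assumes "a < b"
  obtains x where "x \<notin> \<rat>" "a < x" "x < b"
proof -
  have "uncountable {a<..<b}" using assms by (simp add: uncountable_open_interval)
  then have "\<not> {a<..<b} \<subseteq> \<rat>" using countable_rat countable_subset by blast
  then obtain x where "x \<in> {a<..<b}" "x \<notin> \<rat>" by blast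
  then show ?thesis by (intro that[of x]) auto
qed

text \<open>At a rational point the function is discontinuous, since it is \<open>c\<close> at irrational points. At
  an irrational point these force the derivative to vanish, whereas the fractions
  \<open>\<lfloor>n s\<rfloor> / n\<close> give difference quotients bounded away from \<open>0\<close>.\<close>

lemma thomae_perturbation_not_differentiable:
  fixes g w :: "real \<Rightarrow> real"
  assumes ab: "0 \<le> a" "a < b" "a \<in> \<rat>" and \<eta>: "0 < \<eta>" and \<kappa>: "0 < \<kappa>"
    and g: "\<And>s. s \<in> {a..b} \<Longrightarrow> g (\<eta> * s) = c - w s * thomae s"
    and w: "\<And>s. s \<in> {a..b} \<Longrightarrow> \<kappa> \<le> w s"
    and x: "x \<in> {\<eta> * a..\<eta> * b}"
  shows "\<not> g differentiable (at x within {\<eta> * a..\<eta> * b})"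
proof
  let ?S = "{\<eta> * a..\<eta> * b}"
  define s where "s = x / \<eta>"
  have x_eq: "x = \<eta> * s" and s: "s \<in> {a..b}" using x \<eta> by (auto simp: s_def field_simps)
  have S: "\<eta> * t \<in> ?S \<longleftrightarrow> t \<in> {a..b}" for t using \<eta> by auto
  assume diff: "g differentiable (at x within ?S)"
  have irr: "g (\<eta> * t) = c" if "t \<in> {a..b}" "t \<notin> \<rat>" for t
    using g[OF that(1)] denominators_irrational[OF that(2)] by (simp add: thomae_def)
  \<comment> \<open>The approach is from the right, except at \<open>s = b\<close>, where only the
    left side lies in the interval.\<close>
  have near: "\<exists>t. t \<in> {a..b} \<and> t \<notin> \<rat> \<and> t \<noteq> s \<and> \<bar>t - s\<bar> < e" if "e > 0" for e
  proof (cases "s < b")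
    case True
    then have "s < min b (s + e)" using that by simp
    then obtain t where "t \<notin> \<rat>" "s < t" "t < min b (s + e)"
      by (rule exists_irrational_between)
    then show ?thesis using s by (intro exI[of _ t]) auto
  next
    case False
    then have "max a (s - e) < s" using that ab s by auto
    then obtain t where "t \<notin> \<rat>" "max a (s - e) < t" "t < s"
      by (rule exists_irrational_between)
    then show ?thesis using s by (intro exI[of _ t]) auto
  qed
  define t where "t = (\<lambda>n. SOME t. t \<in> {a..b} \<and> t \<notin> \<rat> \<and> t \<noteq> s \<and> \<bar>t - s\<bar> < 1 / real (Suc n))"
  have t: "t n \<in> {a..b}" "t n \<notin> \<rat>" "t n \<noteq> s" "\<bar>t n - s\<bar> < 1 / real (Suc n)" for n
    unfolding t_def using someI_ex[OF near[of "1 / real (Suc n)"]] by auto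
  have "t \<longlonglongrightarrow> s"
  proof (rule LIM_zero_cancel, rule Lim_null_comparison)
    show "\<forall>\<^sub>F n in sequentially. norm (t n - s) \<le> 1 / real (Suc n)"
      using t(4) by (intro always_eventually allI) (simp add: less_imp_le)
    show "(\<lambda>n. 1 / real (Suc n)) \<longlonglongrightarrow> 0"
      using LIMSEQ_inverse_real_of_nat by (simp add: inverse_eq_divide)
  qed
  then have tx: "(\<lambda>n. \<eta> * t n) \<longlonglongrightarrow> x" unfolding x_eq by (intro tendsto_intros)
  have t_at: "filterlim (\<lambda>n. \<eta> * t n) (at x within ?S) sequentially"
    using tx t(1,3) \<eta> S by (auto simp: filterlim_at x_eq)
  show False
  proof (cases "s \<in> \<rat>")
    case True
    have "continuous (at x within ?S) g" using diff by (rule differentiable_imp_continuous_within)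
    then have "(g \<longlongrightarrow> g x) (at x within ?S)" by (simp add: continuous_within)
    then have "(\<lambda>n. g (\<eta> * t n)) \<longlonglongrightarrow> g x" using t_at by (rule filterlim_compose)
    then have "(\<lambda>n. c) \<longlonglongrightarrow> g x" using irr t(1,2) by simp
    then have "g x = c" by (simp add: LIMSEQ_const_iff)
    then have "w s * thomae s = 0" using g[OF s] by (simp add: x_eq)
    moreover have "w s > 0" using w[OF s] \<kappa> by simp
    moreover have "thomae s > 0"
      by (rule thomae_cases[of s]) (use denominators_rational[OF True] s ab in \<open>auto simp: denominators_def\<close>)
    ultimately show False by simp
  next
    case False
    then have gx: "g x = c" using irr[OF s] by (simp add: x_eq)
    obtain D where "(g has_field_derivative D) (at x within ?S)"
      using diff real_differentiable_def by blast
    then have D: "((\<lambda>y. (g y - g x) / (y - x)) \<longlongrightarrow> D) (at x within ?S)"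
      by (simp add: has_field_derivative_iff)
    from filterlim_compose[OF D t_at] have "(\<lambda>n. 0) \<longlonglongrightarrow> D"
      using irr t(1,2) by (simp add: gx)
    then have "D = 0" by (simp add: LIMSEQ_const_iff)
    \<comment> \<open>Rationality of \<open>a\<close> gives an irrational \<open>s\<close> room on
      its left for the fractions \<open>r n\<close>.\<close>
    have "a < s" using s False ab(3) by (cases "a = s") auto
    define r where "r = (\<lambda>n. of_int \<lfloor>real (Suc n) * s\<rfloor> / real (Suc n))"
    have r: "r n \<le> s" "s - r n < 1 / real (Suc n)" for n
    proof -
      let ?e = "real (Suc n) * s - of_int \<lfloor>real (Suc n) * s\<rfloor>"
      have e: "0 \<le> ?e" "?e < 1" by linarith+
      have "s - r n = ?e / real (Suc n)"
        by (simp add: r_def diff_divide_distrib del: of_nat_Suc)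
      moreover have "0 \<le> ?e / real (Suc n)" "?e / real (Suc n) < 1 / real (Suc n)"
        using e by (intro divide_nonneg_pos divide_strict_right_mono; simp)+
      ultimately show "r n \<le> s" "s - r n < 1 / real (Suc n)" by linarith+
    qed
    have rneq: "r n \<noteq> s" for n using False unfolding r_def by (metis Rats_divide Rats_of_int Rats_of_nat)
    have "r \<longlonglongrightarrow> s"
    proof (rule LIM_zero_cancel, rule Lim_null_comparison)
      show "\<forall>\<^sub>F n in sequentially. norm (r n - s) \<le> 1 / real (Suc n)"
        using r by (intro always_eventually allI) (simp add: abs_minus_commute less_imp_le)
      show "(\<lambda>n. 1 / real (Suc n)) \<longlonglongrightarrow> 0"
        using LIMSEQ_inverse_real_of_nat by (simp add: inverse_eq_divide)
    qed
    then have ra: "\<forall>\<^sub>F n in sequentially. a < r n" using \<open>a < s\<close> by (rule order_tendstoD)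
    then have rS: "\<forall>\<^sub>F n in sequentially. r n \<in> {a..b}"
      by eventually_elim (use r(1) s in \<open>auto intro: order_trans less_imp_le\<close>)
    have "(\<lambda>n. \<eta> * r n) \<longlonglongrightarrow> x" unfolding x_eq using \<open>r \<longlonglongrightarrow> s\<close> by (intro tendsto_intros)
    moreover have "\<forall>\<^sub>F n in sequentially. \<eta> * r n \<in> ?S \<and> \<eta> * r n \<noteq> x"
      using rS by eventually_elim (use S \<eta> rneq in \<open>auto simp: x_eq\<close>)
    ultimately have r_at: "filterlim (\<lambda>n. \<eta> * r n) (at x within ?S) sequentially"
      by (simp add: filterlim_at)
    have lim: "(\<lambda>n. (g (\<eta> * r n) - g x) / (\<eta> * r n - x)) \<longlonglongrightarrow> 0"
      using filterlim_compose[OF D r_at] \<open>D = 0\<close> by simp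
    have "\<forall>\<^sub>F n in sequentially. \<kappa> / \<eta> \<le> (g (\<eta> * r n) - g x) / (\<eta> * r n - x)"
      using rS
    proof eventually_elim
      case (elim n)
      have "0 \<le> r n" using elim ab by auto
      have "0 \<le> real (Suc n) * s" using s ab by simp
      then have "r n * real (Suc n) = real (nat \<lfloor>real (Suc n) * s\<rfloor>)"
        by (simp add: r_def del: of_nat_Suc)
      \<comment> \<open>The fraction may be reducible; reduction can only increase
        \<open>thomae (r n)\<close>.\<close>
      then have "Suc n \<in> denominators (r n)" unfolding denominators_def by blast
      then have th: "1 / real (Suc n) \<le> thomae (r n)" by (rule thomae_ge)
      have pos: "0 < s - r n" using r(1)[of n] rneq[of n] by linarith
      have "(g (\<eta> * r n) - g x) / (\<eta> * r n - x) = (w (r n) * thomae (r n)) / (\<eta> * (s - r n))"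
      proof -
        have "g (\<eta> * r n) - g x = - (w (r n) * thomae (r n))" using g[OF elim] gx by simp
        moreover have "\<eta> * r n - x = - (\<eta> * (s - r n))" by (simp add: x_eq algebra_simps)
        ultimately show ?thesis by (simp only: minus_divide_divide)
      qed
      \<comment> \<open>The gap \<open>s - r n\<close> is smaller than
        \<open>1 / real (Suc n)\<close>, hence smaller than \<open>thomae (r n)\<close>; this bounds
        the quotient below by \<open>\<kappa> / \<eta>\<close>.\<close>
      moreover have "\<kappa> * (s - r n) \<le> w (r n) * thomae (r n)"
        using w[OF elim] th r(2)[of n] pos \<kappa> by (intro mult_mono) auto
      then have "\<kappa> * (s - r n) / (\<eta> * (s - r n)) \<le> (w (r n) * thomae (r n)) / (\<eta> * (s - r n))"
        using pos \<eta> by (intro divide_right_mono) auto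
      then have "\<kappa> / \<eta> \<le> (w (r n) * thomae (r n)) / (\<eta> * (s - r n))"
        using pos by simp
      ultimately show ?case by simp
    qed
    then have "\<kappa> / \<eta> \<le> 0" by (rule tendsto_lowerbound[OF lim]) simp
    then show False using \<kappa> \<eta> by (simp add: divide_le_0_iff)
  qed
qed

text \<open>As \<open>psi\<close> is defined by \<open>LEAST\<close>, attainment of the minimum is
  asserted separately. Differentiability is taken within the interval, so one-sided derivatives at
  the end points are excluded as well.\<close>

theorem theorem4p1:
  "\<exists>(f :: quantum_graph) (\<alpha>\<^sub>1 :: real) (\<alpha>\<^sub>2 :: real).
     0 \<le> \<alpha>\<^sub>1 \<and> \<alpha>\<^sub>1 < \<alpha>\<^sub>2 \<and> \<alpha>\<^sub>2 \<le> 1 \<and>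
     (\<forall>x\<in>{\<alpha>\<^sub>1..\<alpha>\<^sub>2}. \<exists>d\<in>feasible f x. \<forall>d'\<in>feasible f x. d \<le> d') \<and>
     (\<forall>x\<in>{\<alpha>\<^sub>1..\<alpha>\<^sub>2}. \<not> psi f differentiable (at x within {\<alpha>\<^sub>1..\<alpha>\<^sub>2}))"
proof -
  obtain f where f: "\<And>W. graphon W \<Longrightarrow> q_density f W = constraint W"
    using representable_constraint unfolding representable_def by blast
  define v where "v s = 79/128 - (1 + 2 * s) / 64 * thomae s" for s
  \<comment> \<open>The range \<open>{1/8..3/8}\<close> stays strictly between 0 and 1/2, as
    \<open>constraint_edge_density\<close> requires, and has a rational left end point.\<close>
  have least: "v s \<in> feasible f (P4_scale * s) \<and> (\<forall>d\<in>feasible f (P4_scale * s). v s \<le> d)"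
    if s: "s \<in> {1/8..3/8}" for s
  proof
    have s': "0 \<le> s" "s \<le> 1/2" using s by auto
    show "v s \<in> feasible f (P4_scale * s)"
    proof (rule thomae_cases[of s])
      assume th: "thomae s = 0"
      obtain W where "graphon W" "constraint W = 0" "ind_density P4 W = P4_scale * s"
        "ind_density K2 W = 79/128"
        using ex_model_generic[OF s'] by blast
      then show ?thesis unfolding feasible_def v_def th using f by force
    next
      fix n assume "n \<in> denominators s" and th: "thomae s = 1 / real n"
      then obtain l where "0 < n" "s * real n = real l" by (auto simp: denominators_def)
      from ex_model_rational[OF s' this] obtain W where "graphon W" "constraint W = 0"
        "ind_density P4 W = P4_scale * s" "ind_density K2 W = 79/128 - (1 + 2 * s) / (64 * real n)"
        by blast
      then show ?thesis unfolding feasible_def v_def th using f by force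
    qed
    show "\<forall>d\<in>feasible f (P4_scale * s). v s \<le> d"
    proof
      fix d assume "d \<in> feasible f (P4_scale * s)"
      then obtain W where W: "graphon W" "constraint W = 0" "ind_density P4 W = P4_scale * s"
        and d: "d = ind_density K2 W" using f by (auto simp: feasible_def)
      have sW: "P4_param W = s" using P4_scale_pos W(3) by (simp add: P4_param_def)
      have th0: "0 \<le> thomae s" by (rule thomae_cases[of s]) auto
      show "v s \<le> d"
      proof (rule constraint_edge_density[OF W(1,2)])
        show "0 < P4_param W" "P4_param W < 1/2" using s sW by auto
        assume "ind_density K2 W = 79/128"
        moreover have "0 \<le> (1 + 2 * s) / 64 * thomae s" using th0 s by simp
        ultimately show ?thesis unfolding d v_def by linarith
      next
        fix n l :: nat
        assume n: "0 < n" "P4_param W * real n = real l"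
          and K2: "ind_density K2 W = 79/128 - (1 + 2 * P4_param W) / (64 * real n)"
        then have "1 / real n \<le> thomae s" by (intro thomae_ge) (auto simp: denominators_def sW)
        then have "(1 + 2 * s) / 64 * (1 / real n) \<le> (1 + 2 * s) / 64 * thomae s"
          using s by (intro mult_left_mono) auto
        then show ?thesis using K2 by (simp add: d v_def sW)
      qed
    qed
  qed
  have psi: "psi f (P4_scale * s) = 79/128 - (1 + 2 * s) / 64 * thomae s" if "s \<in> {1/8..3/8}" for s
    unfolding psi_def v_def[symmetric] using least[OF that] by (intro Least_equality) auto
  show ?thesis
  proof (intro exI conjI ballI)
    show "0 \<le> P4_scale * (1/8)" "P4_scale * (1/8) < P4_scale * (3/8)" "P4_scale * (3/8) \<le> 1"
      by (simp_all add: P4_scale_def power_divide)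
    fix x assume x: "x \<in> {P4_scale * (1/8)..P4_scale * (3/8)}"
    show "\<not> psi f differentiable (at x within {P4_scale * (1/8)..P4_scale * (3/8)})"
      by (rule thomae_perturbation_not_differentiable[OF _ _ _ P4_scale_pos _ psi _ x, where \<kappa> = "1/64"]) auto
    have "x / P4_scale \<in> {1/8..3/8}" using x P4_scale_pos by (auto simp: field_simps)
    from least[OF this] show "\<exists>d\<in>feasible f x. \<forall>d'\<in>feasible f x. d \<le> d'"
      using P4_scale_pos by auto
  qed
qed

end
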